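(* Let $\mathrm{C} \in \{\text{Regular}, \text{CF}, \text{CS}, \text{RE}\}$ and let $G$ be a group with finite subsets $X, Y \subseteq G$, each of which generates $G$ as a monoid. If $G$ is epiC with respect to $X$, then $G$ is epiC with respect to $Y$.
   Context: Formal languages. For a set $X$, $X^*$ denotes the free monoid of all finite strings over $X$, including the empty string $\varepsilon$; a language over a finite alphabet $X$ is a subset of $X^*$. The language classes are the standard Chomsky classes: Regular (accepted by a finite state automaton), CF = context-free (accepted by a pushdown automaton), CS = context-sensitive (accepted by a linearly bounded automaton), RE = recursively enumerable (accepted by a Turing machine). For a group $G$ and $X\subseteq G$, and $w\in X^*$, $g \in G$, write $w=_G g$ if the product in $G$ of the letters of $w$ equals $g$ (the empty string evaluates to $1_G$). Let $X\subseteq G$ be finite and generate $G$ as a monoid. $G$ is epiC with respect to $X$ if there is a language $L\subseteq X^*$ in the class C such that (i) no word $w\in L$ satisfies $w=_G 1_G$, and (ii) for every $h\in G\setminus\{1_G\}$ there is $w_h\in L$ with $w_h=_G h$. *)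

theory Defs
  imports "HOL-Algebra.Group"
begin

text \<open>
  All automata below are nondeterministic. A machine is given by an initial state, a set of final
  states and a transition relation, both sets being finite; the state set, the stack alphabet and
  the tape alphabet are not listed separately, since only the finitely many states and symbols that
  occur in the machine matter. For the same reason it is no loss that the language classes draw
  states and auxiliary symbols from the type of natural numbers. The input alphabet is an arbitrary
  set \<open>X\<close> of elements of a type.
\<close>

definition opt_word :: "'a option \<Rightarrow> 'a list" where
  "opt_word a = (case a of None \<Rightarrow> [] | Some x \<Rightarrow> [x])"


section \<open>Finite state automata\<close>

text \<open>The label \<^term>\<open>None\<close> of a transition stands for a move that reads no input.\<close>

record ('q, 'a) fsa =
  fsa_init :: 'q
  fsa_final :: "'q set"
  fsa_trans :: "('q \<times> 'a option \<times> 'q) set"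

definition is_fsa :: "'a set \<Rightarrow> ('q, 'a) fsa \<Rightarrow> bool" where
  "is_fsa X M \<longleftrightarrow> finite (fsa_final M) \<and> finite (fsa_trans M) \<and>
     (\<forall>(p, a, q) \<in> fsa_trans M. set_option a \<subseteq> X)"

inductive fsa_step :: "('q, 'a) fsa \<Rightarrow> 'q \<times> 'a list \<Rightarrow> 'q \<times> 'a list \<Rightarrow> bool" for M where
  "(p, a, q) \<in> fsa_trans M \<Longrightarrow> fsa_step M (p, opt_word a @ w) (q, w)"

definition fsa_lang :: "'a set \<Rightarrow> ('q, 'a) fsa \<Rightarrow> 'a list set" where
  "fsa_lang X M = {w \<in> lists X. \<exists>f \<in> fsa_final M. (fsa_step M)\<^sup>*\<^sup>* (fsa_init M, w) (f, [])}"


section \<open>Pushdown automata\<close>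

text \<open>
  A transition \<open>(p, a, Z, q, \<gamma>)\<close> reads \<open>a\<close> (or nothing), pops \<open>Z\<close> and pushes \<open>\<gamma>\<close>; the head of the
  list is the top of the stack. Acceptance is by final state.
\<close>

record ('q, 'a, 's) pda =
  pda_init :: 'q
  pda_bottom :: 's
  pda_final :: "'q set"
  pda_trans :: "('q \<times> 'a option \<times> 's \<times> 'q \<times> 's list) set"

definition is_pda :: "'a set \<Rightarrow> ('q, 'a, 's) pda \<Rightarrow> bool" where
  "is_pda X M \<longleftrightarrow> finite (pda_final M) \<and> finite (pda_trans M) \<and>
     (\<forall>(p, a, Z, q, \<gamma>) \<in> pda_trans M. set_option a \<subseteq> X)"

inductive pda_step ::
  "('q, 'a, 's) pda \<Rightarrow> 'q \<times> 'a list \<times> 's list \<Rightarrow> 'q \<times> 'a list \<times> 's list \<Rightarrow> bool" for M where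
  "(p, a, Z, q, \<gamma>) \<in> pda_trans M \<Longrightarrow>
     pda_step M (p, opt_word a @ w, Z # \<beta>) (q, w, \<gamma> @ \<beta>)"

definition pda_lang :: "'a set \<Rightarrow> ('q, 'a, 's) pda \<Rightarrow> 'a list set" where
  "pda_lang X M = {w \<in> lists X. \<exists>f \<in> pda_final M. \<exists>\<beta>.
     (pda_step M)\<^sup>*\<^sup>* (pda_init M, w, [pda_bottom M]) (f, [], \<beta>)}"


section \<open>Turing machines and linearly bounded automata\<close>

datatype ('a, 's) symbol = Input 'a | Work 's | Blank | LeftEnd | RightEnd

datatype move = MoveLeft | Stay | MoveRight

fun shift :: "move \<Rightarrow> int" where
  "shift MoveLeft = -1"
| "shift Stay = 0"
| "shift MoveRight = 1"

text \<open>
  A transition \<open>(p, s, q, t, d)\<close> is applicable in state \<open>p\<close> when the head scans \<open>s\<close>; it replaces \<open>s\<close> by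
  \<open>t\<close>, moves the head according to \<open>d\<close> and enters state \<open>q\<close>. A configuration consists of the state,
  the head position and the contents of a single two-way infinite tape. An input is accepted if some
  computation on it reaches a final state.
\<close>

record ('q, 'a, 's) tm =
  tm_init :: 'q
  tm_final :: "'q set"
  tm_trans :: "('q \<times> ('a, 's) symbol \<times> 'q \<times> ('a, 's) symbol \<times> move) set"

inductive tm_step ::
  "('q, 'a, 's) tm \<Rightarrow> 'q \<times> int \<times> (int \<Rightarrow> ('a, 's) symbol) \<Rightarrow>
     'q \<times> int \<times> (int \<Rightarrow> ('a, 's) symbol) \<Rightarrow> bool" for M where
  "(p, tape h, q, t, d) \<in> tm_trans M \<Longrightarrow>
     tm_step M (p, h, tape) (q, h + shift d, tape(h := t))"

definition is_tm :: "'a set \<Rightarrow> ('q, 'a, 's) tm \<Rightarrow> bool" where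
  "is_tm X M \<longleftrightarrow> finite (tm_final M) \<and> finite (tm_trans M) \<and>
     (\<forall>(p, s, q, t, d) \<in> tm_trans M.
        {s, t} \<subseteq> Input ` X \<union> range Work \<union> {Blank})"

definition tm_tape :: "'a list \<Rightarrow> int \<Rightarrow> ('a, 's) symbol" where
  "tm_tape w i = (if 0 \<le> i \<and> i < int (length w) then Input (w ! nat i) else Blank)"

definition tm_lang :: "'a set \<Rightarrow> ('q, 'a, 's) tm \<Rightarrow> 'a list set" where
  "tm_lang X M = {w \<in> lists X. \<exists>f \<in> tm_final M. \<exists>h tape.
     (tm_step M)\<^sup>*\<^sup>* (tm_init M, 0, tm_tape w) (f, h, tape)}"

text \<open>
  A linearly bounded automaton finds its input between two end markers, which it can neither
  overwrite nor pass nor print elsewhere; so it never leaves the cells \<open>0, \<dots>, length w + 1\<close>, and the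
  blanks outside this range are never scanned.
\<close>

definition is_lba :: "'a set \<Rightarrow> ('q, 'a, 's) tm \<Rightarrow> bool" where
  "is_lba X M \<longleftrightarrow> finite (tm_final M) \<and> finite (tm_trans M) \<and>
     (\<forall>(p, s, q, t, d) \<in> tm_trans M.
        {s, t} \<subseteq> Input ` X \<union> range Work \<or>
        s = LeftEnd \<and> t = LeftEnd \<and> d \<noteq> MoveLeft \<or>
        s = RightEnd \<and> t = RightEnd \<and> d \<noteq> MoveRight)"

definition lba_tape :: "'a list \<Rightarrow> int \<Rightarrow> ('a, 's) symbol" where
  "lba_tape w i =
     (if i = 0 then LeftEnd
      else if 1 \<le> i \<and> i \<le> int (length w) then Input (w ! nat (i - 1))
      else if i = int (length w) + 1 then RightEnd
      else Blank)"

definition lba_lang :: "'a set \<Rightarrow> ('q, 'a, 's) tm \<Rightarrow> 'a list set" where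
  "lba_lang X M = {w \<in> lists X. \<exists>f \<in> tm_final M. \<exists>h tape.
     (tm_step M)\<^sup>*\<^sup>* (tm_init M, 0, lba_tape w) (f, h, tape)}"


section \<open>Language classes\<close>

datatype lang_class = Regular | CF | CS | RE

fun in_class :: "lang_class \<Rightarrow> 'a set \<Rightarrow> 'a list set \<Rightarrow> bool" where
  "in_class Regular X L \<longleftrightarrow> (\<exists>M :: (nat, 'a) fsa. is_fsa X M \<and> L = fsa_lang X M)"
| "in_class CF X L \<longleftrightarrow> (\<exists>M :: (nat, 'a, nat) pda. is_pda X M \<and> L = pda_lang X M)"
| "in_class CS X L \<longleftrightarrow> (\<exists>M :: (nat, 'a, nat) tm. is_lba X M \<and> L = lba_lang X M)"
| "in_class RE X L \<longleftrightarrow> (\<exists>M :: (nat, 'a, nat) tm. is_tm X M \<and> L = tm_lang X M)"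


section \<open>Words in groups\<close>

definition word_value :: "('a, 'b) monoid_scheme \<Rightarrow> 'a list \<Rightarrow> 'a" where
  "word_value G w = foldr (\<otimes>\<^bsub>G\<^esub>) w \<one>\<^bsub>G\<^esub>"

definition generates_as_monoid :: "('a, 'b) monoid_scheme \<Rightarrow> 'a set \<Rightarrow> bool" where
  "generates_as_monoid G X \<longleftrightarrow>
     X \<subseteq> carrier G \<and> (\<forall>g \<in> carrier G. \<exists>w \<in> lists X. word_value G w = g)"

definition epiC :: "lang_class \<Rightarrow> ('a, 'b) monoid_scheme \<Rightarrow> 'a set \<Rightarrow> bool" where
  "epiC C G X \<longleftrightarrow> (\<exists>L \<subseteq> lists X. in_class C X L \<and>
     (\<forall>w \<in> L. word_value G w \<noteq> \<one>\<^bsub>G\<^esub>) \<and>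
     (\<forall>h \<in> carrier G - {\<one>\<^bsub>G\<^esub>}. \<exists>w \<in> L. word_value G w = h))"

end

theory Submission
  imports Defs "HOL-Library.Sublist"
begin

text \<open>
  Every \<open>x\<close> in \<open>X\<close> is the value of some nonempty word \<open>f x\<close> over \<open>Y\<close>. Replacing each letter of a
  word over \<open>X\<close> by its word over \<open>Y\<close> does not change the value in the group, so if a language \<open>L\<close> over
  \<open>X\<close> represents exactly the nontrivial elements, then so does its image under the homomorphism
  extending \<open>f\<close>. The theorem thus reduces to the closure of each of the four language classes under
  nonerasing homomorphisms (\<open>in_class_image\<close>). Nonempty words over \<open>Y\<close> exist unless \<open>Y\<close> is empty; in
  that case the group is trivial and the empty language can be used.

  The automata being nondeterministic, a machine for the image may guess how its input factors into
  images of letters. Finite and pushdown automata keep the part of the current factor that has been read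
  in their finite control and perform a move of the original machine once the factor is complete
  (\<open>fsa_lang_image\<close>, \<open>pda_lang_image\<close>).

  Turing machines and linearly bounded automata are treated together. The factorisation is written on
  the tape in place of the input, each factor being replaced by its letter, preceded by as many filler
  cells as are needed to keep its length; this takes no extra space because no factor is empty. The
  original machine is then simulated on this stretched tape. The simulation is described by a strictly
  increasing map from the cells of the original tape to the cells representing them. Crossing filler
  cells corresponds to no move of the original machine, and everything else to exactly one
  (\<open>tracks_forward\<close>, \<open>tracks_backward\<close>). That every accepting computation really begins with a complete
  decoding is the content of the invariant \<open>phase\<close> (\<open>tm_lang_image\<close>, \<open>lba_lang_image\<close>).
\<close>

section \<open>Simulations and the choice of state types\<close>

text \<open>
  The invariant and the correspondence between configurations are both carried by \<open>R\<close>. Used with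
  \<open>\<lambda>c' c. R c c'\<close> it also transports computations in the opposite direction.
\<close>

lemma rtranclp_simulation:
  assumes "S\<^sup>*\<^sup>* c d" and "R c c'"
    and step: "\<And>c d c'. S c d \<Longrightarrow> R c c' \<Longrightarrow> \<exists>d'. S'\<^sup>*\<^sup>* c' d' \<and> R d d'"
  shows "\<exists>d'. S'\<^sup>*\<^sup>* c' d' \<and> R d d'"
  using assms(1)
proof induction
  case base
  then show ?case using assms(2) by blast
next
  case (step d e)
  then show ?case by (meson assms(3) rtranclp_trans)
qed

lemma finite_inj_on_nat:
  assumes "finite A"
  obtains h :: "'a \<Rightarrow> nat" where "inj_on h A"
  using finite_imp_inj_to_nat_seg[OF assms] by blast

text \<open>
  The machines constructed below have structured states such as pairs or terms of a datatype, whereas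
  the language classes speak of machines over the natural numbers. Only finitely many states and
  symbols occur in a machine, so it can be renamed along a map that is injective on these. As the map
  may identify other states, the simulations that show that the language is unchanged carry the
  invariant that only states and symbols of the machine occur.
\<close>

definition fsa_states :: "('q, 'a) fsa \<Rightarrow> 'q set" where
  "fsa_states M = insert (fsa_init M) (fsa_final M \<union> (\<Union>(p, a, q)\<in>fsa_trans M. {p, q}))"

definition rename_fsa :: "('q \<Rightarrow> 'r) \<Rightarrow> ('q, 'a) fsa \<Rightarrow> ('r, 'a) fsa" where
  "rename_fsa h M = \<lparr>fsa_init = h (fsa_init M), fsa_final = h ` fsa_final M,
     fsa_trans = (\<lambda>(p, a, q). (h p, a, h q)) ` fsa_trans M\<rparr>"

lemma fsa_lang_rename:
  fixes M :: "('q, 'a) fsa" and h :: "'q \<Rightarrow> 'r"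
  assumes inj: "inj_on h (fsa_states M)"
  shows "fsa_lang X (rename_fsa h M) = fsa_lang X M"
proof -
  let ?N = "rename_fsa h M"
  define R :: "'q \<times> 'a list \<Rightarrow> 'r \<times> 'a list \<Rightarrow> bool"
    where "R = (\<lambda>c c'. fst c \<in> fsa_states M \<and> c' = apfst h c)"
  have fwd: "\<exists>d'. (fsa_step ?N)\<^sup>*\<^sup>* c' d' \<and> R d d'" if "fsa_step M c d" "R c c'" for c d c'
    using that(1)
  proof cases
    case (1 p a q w)
    have "fsa_step ?N (h p, opt_word a @ w) (h q, w)"
      by (rule fsa_step.intros) (use 1 in \<open>force simp: rename_fsa_def\<close>)
    moreover have "q \<in> fsa_states M" using 1 by (force simp: fsa_states_def)
    ultimately show ?thesis using 1 that(2) by (auto simp: R_def)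
  qed
  have bwd: "\<exists>d. (fsa_step M)\<^sup>*\<^sup>* c d \<and> R d d'" if "fsa_step ?N c' d'" "R c c'" for c c' d'
    using that(1)
  proof cases
    case (1 p' a q' w)
    then obtain p q where t: "(p, a, q) \<in> fsa_trans M" "p' = h p" "q' = h q"
      by (auto simp: rename_fsa_def)
    have st: "p \<in> fsa_states M" "q \<in> fsa_states M" using t by (force simp: fsa_states_def)+
    then have "c = (p, opt_word a @ w)"
      using that(2) 1 t inj by (cases c) (auto simp: R_def inj_on_def)
    then have "fsa_step M c (q, w)" using t by (auto intro: fsa_step.intros)
    then show ?thesis using 1 t st by (auto simp: R_def)
  qed
  have R0: "R (fsa_init M, w) (fsa_init ?N, w)" for w
    by (auto simp: R_def fsa_states_def rename_fsa_def)
  show ?thesis (is "?A = ?B")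
  proof
    show "?A \<subseteq> ?B"
    proof
      fix w assume "w \<in> ?A"
      then obtain f where f: "w \<in> lists X" "f \<in> fsa_final M"
        "(fsa_step ?N)\<^sup>*\<^sup>* (fsa_init ?N, w) (h f, [])"
        by (auto simp: fsa_lang_def rename_fsa_def)
      have "\<exists>d. (fsa_step M)\<^sup>*\<^sup>* (fsa_init M, w) d \<and> R d (h f, [])"
        by (rule rtranclp_simulation[of _ _ _ "\<lambda>c' c. R c c'", OF f(3) R0 bwd])
      then obtain d where d: "(fsa_step M)\<^sup>*\<^sup>* (fsa_init M, w) d" "R d (h f, [])" by blast
      have "f \<in> fsa_states M" using f by (auto simp: fsa_states_def)
      then have "d = (f, [])" using d(2) inj by (cases d) (auto simp: R_def inj_on_def)
      then show "w \<in> ?B" using f d by (auto simp: fsa_lang_def)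
    qed
    show "?B \<subseteq> ?A"
    proof
      fix w assume "w \<in> ?B"
      then obtain f where f: "w \<in> lists X" "f \<in> fsa_final M"
        "(fsa_step M)\<^sup>*\<^sup>* (fsa_init M, w) (f, [])"
        by (auto simp: fsa_lang_def)
      have "\<exists>d'. (fsa_step ?N)\<^sup>*\<^sup>* (fsa_init ?N, w) d' \<and> R (f, []) d'"
        by (rule rtranclp_simulation[of _ _ _ R, OF f(3) R0 fwd])
      then show "w \<in> ?A" using f by (auto simp: fsa_lang_def R_def rename_fsa_def)
    qed
  qed
qed

lemma in_class_RegularI:
  fixes M :: "('q, 'a) fsa"
  assumes M: "is_fsa X M"
  shows "in_class Regular X (fsa_lang X M)"
proof -
  have "finite (fsa_states M)" using M by (auto simp: is_fsa_def fsa_states_def)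
  then obtain h :: "'q \<Rightarrow> nat" where "inj_on h (fsa_states M)" by (rule finite_inj_on_nat)
  then have "fsa_lang X M = fsa_lang X (rename_fsa h M)" by (simp add: fsa_lang_rename)
  moreover have "is_fsa X (rename_fsa h M)"
    using M by (fastforce simp: is_fsa_def rename_fsa_def)
  ultimately show ?thesis by auto
qed

definition pda_states :: "('q, 'a, 's) pda \<Rightarrow> 'q set" where
  "pda_states M = insert (pda_init M) (pda_final M \<union> (\<Union>(p, a, Z, q, \<gamma>)\<in>pda_trans M. {p, q}))"

definition rename_pda :: "('q \<Rightarrow> 'r) \<Rightarrow> ('q, 'a, 's) pda \<Rightarrow> ('r, 'a, 's) pda" where
  "rename_pda h M = \<lparr>pda_init = h (pda_init M), pda_bottom = pda_bottom M,
     pda_final = h ` pda_final M,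
     pda_trans = (\<lambda>(p, a, Z, q, \<gamma>). (h p, a, Z, h q, \<gamma>)) ` pda_trans M\<rparr>"

lemma pda_lang_rename:
  fixes M :: "('q, 'a, 's) pda" and h :: "'q \<Rightarrow> 'r"
  assumes inj: "inj_on h (pda_states M)"
  shows "pda_lang X (rename_pda h M) = pda_lang X M"
proof -
  let ?N = "rename_pda h M"
  define R :: "'q \<times> 'a list \<times> 's list \<Rightarrow> 'r \<times> 'a list \<times> 's list \<Rightarrow> bool"
    where "R = (\<lambda>c c'. fst c \<in> pda_states M \<and> c' = apfst h c)"
  have fwd: "\<exists>d'. (pda_step ?N)\<^sup>*\<^sup>* c' d' \<and> R d d'" if "pda_step M c d" "R c c'" for c d c'
    using that(1)
  proof cases
    case (1 p a Z q \<gamma> w \<beta>)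
    have "pda_step ?N (h p, opt_word a @ w, Z # \<beta>) (h q, w, \<gamma> @ \<beta>)"
      by (rule pda_step.intros) (use 1 in \<open>force simp: rename_pda_def\<close>)
    moreover have "q \<in> pda_states M" using 1 by (force simp: pda_states_def)
    ultimately show ?thesis using 1 that(2) by (auto simp: R_def)
  qed
  have bwd: "\<exists>d. (pda_step M)\<^sup>*\<^sup>* c d \<and> R d d'" if "pda_step ?N c' d'" "R c c'" for c c' d'
    using that(1)
  proof cases
    case (1 p' a Z q' \<gamma> w \<beta>)
    then obtain p q where t: "(p, a, Z, q, \<gamma>) \<in> pda_trans M" "p' = h p" "q' = h q"
      by (auto simp: rename_pda_def)
    have st: "p \<in> pda_states M" "q \<in> pda_states M" using t by (force simp: pda_states_def)+
    then have "c = (p, opt_word a @ w, Z # \<beta>)"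
      using that(2) 1 t inj by (cases c) (auto simp: R_def inj_on_def)
    then have "pda_step M c (q, w, \<gamma> @ \<beta>)" using t by (auto intro: pda_step.intros)
    then show ?thesis using 1 t st by (auto simp: R_def)
  qed
  have R0: "R (pda_init M, w, [pda_bottom M]) (pda_init ?N, w, [pda_bottom ?N])" for w
    by (auto simp: R_def pda_states_def rename_pda_def)
  show ?thesis (is "?A = ?B")
  proof
    show "?A \<subseteq> ?B"
    proof
      fix w assume "w \<in> ?A"
      then obtain f \<beta> where f: "w \<in> lists X" "f \<in> pda_final M"
        "(pda_step ?N)\<^sup>*\<^sup>* (pda_init ?N, w, [pda_bottom ?N]) (h f, [], \<beta>)"
        by (auto simp: pda_lang_def rename_pda_def)
      have "\<exists>d. (pda_step M)\<^sup>*\<^sup>* (pda_init M, w, [pda_bottom M]) d \<and> R d (h f, [], \<beta>)"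
        by (rule rtranclp_simulation[of _ _ _ "\<lambda>c' c. R c c'", OF f(3) R0 bwd])
      then obtain d where d: "(pda_step M)\<^sup>*\<^sup>* (pda_init M, w, [pda_bottom M]) d"
        "R d (h f, [], \<beta>)" by blast
      have "f \<in> pda_states M" using f by (auto simp: pda_states_def)
      then have "d = (f, [], \<beta>)" using d(2) inj by (cases d) (auto simp: R_def inj_on_def)
      then show "w \<in> ?B" using f d by (auto simp: pda_lang_def)
    qed
    show "?B \<subseteq> ?A"
    proof
      fix w assume "w \<in> ?B"
      then obtain f \<beta> where f: "w \<in> lists X" "f \<in> pda_final M"
        "(pda_step M)\<^sup>*\<^sup>* (pda_init M, w, [pda_bottom M]) (f, [], \<beta>)"
        by (auto simp: pda_lang_def)
      have "\<exists>d'. (pda_step ?N)\<^sup>*\<^sup>* (pda_init ?N, w, [pda_bottom ?N]) d' \<and> R (f, [], \<beta>) d'"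
        by (rule rtranclp_simulation[of _ _ _ R, OF f(3) R0 fwd])
      then show "w \<in> ?A" using f by (fastforce simp: pda_lang_def R_def rename_pda_def)
    qed
  qed
qed

lemma in_class_CFI:
  fixes M :: "('q, 'a, nat) pda"
  assumes M: "is_pda X M"
  shows "in_class CF X (pda_lang X M)"
proof -
  have "finite (pda_states M)" using M by (auto simp: is_pda_def pda_states_def)
  then obtain h :: "'q \<Rightarrow> nat" where "inj_on h (pda_states M)" by (rule finite_inj_on_nat)
  then have "pda_lang X M = pda_lang X (rename_pda h M)" by (simp add: pda_lang_rename)
  moreover have "is_pda X (rename_pda h M)"
    using M by (fastforce simp: is_pda_def rename_pda_def)
  ultimately show ?thesis by auto
qed

text \<open>
  Turing machines and linearly bounded automata differ only in the tape on which they are started, so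
  the constructions below are carried out for acceptance from an arbitrary initial tape.
\<close>

definition tm_accepts :: "('q, 'a, 's) tm \<Rightarrow> (int \<Rightarrow> ('a, 's) symbol) \<Rightarrow> bool" where
  "tm_accepts M T \<longleftrightarrow> (\<exists>f \<in> tm_final M. \<exists>h T'. (tm_step M)\<^sup>*\<^sup>* (tm_init M, 0, T) (f, h, T'))"

lemma tm_lang_accepts: "tm_lang X M = {w \<in> lists X. tm_accepts M (tm_tape w)}"
  by (simp add: tm_lang_def tm_accepts_def)

lemma lba_lang_accepts: "lba_lang X M = {w \<in> lists X. tm_accepts M (lba_tape w)}"
  by (simp add: lba_lang_def tm_accepts_def)

definition tm_states :: "('q, 'a, 's) tm \<Rightarrow> 'q set" where
  "tm_states M = insert (tm_init M) (tm_final M \<union> (\<Union>(p, s, q, t, d)\<in>tm_trans M. {p, q}))"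

definition tm_work :: "('q, 'a, 's) tm \<Rightarrow> 's set" where
  "tm_work M = (\<Union>(p, s, q, t, d)\<in>tm_trans M. set2_symbol s \<union> set2_symbol t)"

definition rename_tm ::
  "('q \<Rightarrow> 'r) \<Rightarrow> ('s \<Rightarrow> 't) \<Rightarrow> ('q, 'a, 's) tm \<Rightarrow> ('r, 'a, 't) tm" where
  "rename_tm h k M = \<lparr>tm_init = h (tm_init M), tm_final = h ` tm_final M,
     tm_trans = (\<lambda>(p, s, q, t, d). (h p, map_symbol id k s, h q, map_symbol id k t, d)) `
       tm_trans M\<rparr>"

lemma tm_accepts_rename:
  fixes M :: "('q, 'a, 's) tm" and h :: "'q \<Rightarrow> 'r" and k :: "'s \<Rightarrow> 't"
  assumes injh: "inj_on h (tm_states M)" and injk: "inj_on k (tm_work M)"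
    and T0: "\<And>i. set2_symbol (T0 i) = {}"
  shows "tm_accepts (rename_tm h k M) (map_symbol id k \<circ> T0) \<longleftrightarrow> tm_accepts M T0"
proof -
  let ?N = "rename_tm h k M" and ?m = "map_symbol id k"
  define R :: "'q \<times> int \<times> (int \<Rightarrow> ('a, 's) symbol) \<Rightarrow> 'r \<times> int \<times> (int \<Rightarrow> ('a, 't) symbol) \<Rightarrow> bool"
    where "R = (\<lambda>c c'. case c of (q, i, T) \<Rightarrow>
    q \<in> tm_states M \<and> (\<forall>j. set2_symbol (T j) \<subseteq> tm_work M) \<and> c' = (h q, i, ?m \<circ> T))"
  have inv: "p \<in> tm_states M \<and> q \<in> tm_states M \<and>
      set2_symbol s \<subseteq> tm_work M \<and> set2_symbol t \<subseteq> tm_work M"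
    if "(p, s, q, t, d) \<in> tm_trans M" for p s q t d
    using that by (force simp: tm_states_def tm_work_def)
  have injm: "s = t" if "?m s = ?m t" "set2_symbol s \<subseteq> tm_work M" "set2_symbol t \<subseteq> tm_work M"
    for s t :: "('a, 's) symbol"
    by (rule symbol.inj_map_strong[OF _ _ that(1)])
      (use that injk in \<open>auto simp: inj_on_def\<close>)
  have fwd: "\<exists>d'. (tm_step ?N)\<^sup>*\<^sup>* c' d' \<and> R d d'" if "tm_step M c d" "R c c'" for c d c'
    using that(1)
  proof cases
    case (1 p T i q t e)
    have "tm_step ?N (h p, i, ?m \<circ> T) (h q, i + shift e, (?m \<circ> T)(i := ?m t))"
      by (rule tm_step.intros) (use 1 in \<open>force simp: rename_tm_def\<close>)
    then show ?thesis using 1 that(2) inv[OF 1(3)] by (auto simp: R_def fun_upd_comp)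
  qed
  have bwd: "\<exists>d. (tm_step M)\<^sup>*\<^sup>* c d \<and> R d d'" if st: "tm_step ?N c' d'" and rel: "R c c'" for c c' d'
    using st
  proof cases
    case (1 p' T' i q' t' e)
    obtain r T where c: "c = (r, i, T)" "p' = h r" "T' = ?m \<circ> T" "r \<in> tm_states M"
      "\<And>j. set2_symbol (T j) \<subseteq> tm_work M"
      using rel 1 by (cases c) (auto simp: R_def)
    obtain p q s t where t: "(p, s, q, t, e) \<in> tm_trans M" "p' = h p" "q' = h q"
      "T' i = ?m s" "t' = ?m t"
      using 1(3) by (auto simp: rename_tm_def)
    note iv = inv[OF t(1)]
    have "r = p" using c t iv injh by (auto simp: inj_on_def)
    moreover have "T i = s" using c t iv by (intro injm) auto
    ultimately have "tm_step M c (q, i + shift e, T(i := t))"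
      using t c by (auto intro: tm_step.intros)
    moreover have "R (q, i + shift e, T(i := t)) d'"
      using 1 t c iv by (auto simp: R_def fun_upd_comp)
    ultimately show ?thesis by blast
  qed
  have R0: "R (tm_init M, 0, T0) (tm_init ?N, 0, ?m \<circ> T0)"
    using T0 by (auto simp: R_def tm_states_def rename_tm_def)
  show ?thesis (is "?A = ?B")
  proof
    assume ?A
    then obtain f i T where f: "f \<in> tm_final M"
      "(tm_step ?N)\<^sup>*\<^sup>* (tm_init ?N, 0, ?m \<circ> T0) (h f, i, T)"
      by (auto simp: tm_accepts_def rename_tm_def)
    have "\<exists>d. (tm_step M)\<^sup>*\<^sup>* (tm_init M, 0, T0) d \<and> R d (h f, i, T)"
      by (rule rtranclp_simulation[of _ _ _ "\<lambda>c' c. R c c'", OF f(2) R0 bwd])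
    then obtain q j S where d: "(tm_step M)\<^sup>*\<^sup>* (tm_init M, 0, T0) (q, j, S)"
      "R (q, j, S) (h f, i, T)" by (metis prod_cases3)
    have "f \<in> tm_states M" using f by (auto simp: tm_states_def)
    then have "q = f" using d(2) injh by (auto simp: R_def inj_on_def)
    then show ?B using f d by (auto simp: tm_accepts_def)
  next
    assume ?B
    then obtain f i T where f: "f \<in> tm_final M"
      "(tm_step M)\<^sup>*\<^sup>* (tm_init M, 0, T0) (f, i, T)"
      by (auto simp: tm_accepts_def)
    have "\<exists>d'. (tm_step ?N)\<^sup>*\<^sup>* (tm_init ?N, 0, ?m \<circ> T0) d' \<and> R (f, i, T) d'"
      by (rule rtranclp_simulation[of _ _ _ R, OF f(2) R0 fwd])
    then show ?A using f by (fastforce simp: tm_accepts_def R_def rename_tm_def)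
  qed
qed

lemma finite_tm_states: "finite (tm_final M) \<Longrightarrow> finite (tm_trans M) \<Longrightarrow> finite (tm_states M)"
  by (auto simp: tm_states_def)

lemma finite_tm_work: "finite (tm_trans M) \<Longrightarrow> finite (tm_work M)"
proof -
  have "finite (set2_symbol s)" for s :: "('a, 'b) symbol" by (cases s) auto
  then show "finite (tm_trans M) \<Longrightarrow> finite (tm_work M)" by (auto simp: tm_work_def)
qed

lemma in_class_REI:
  fixes M :: "('q, 'a, 's) tm"
  assumes M: "is_tm X M"
  shows "in_class RE X (tm_lang X M)"
proof -
  have fin: "finite (tm_states M)" "finite (tm_work M)"
    using M by (auto simp: is_tm_def intro: finite_tm_states finite_tm_work)
  obtain h :: "'q \<Rightarrow> nat" where h: "inj_on h (tm_states M)" using fin(1) by (rule finite_inj_on_nat)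
  obtain k :: "'s \<Rightarrow> nat" where k: "inj_on k (tm_work M)" using fin(2) by (rule finite_inj_on_nat)
  have tape: "map_symbol id k \<circ> tm_tape w = tm_tape w" for w :: "'a list"
    by (auto simp: tm_tape_def fun_eq_iff)
  have "tm_accepts (rename_tm h k M) (map_symbol id k \<circ> tm_tape w) \<longleftrightarrow> tm_accepts M (tm_tape w)"
    for w by (rule tm_accepts_rename[OF h k]) (auto simp: tm_tape_def)
  then have "tm_lang X M = tm_lang X (rename_tm h k M)" by (simp add: tm_lang_accepts tape)
  moreover have "is_tm X (rename_tm h k M)"
    using M by (fastforce simp: is_tm_def rename_tm_def)
  ultimately show ?thesis by auto
qed

lemma in_class_CSI:
  fixes M :: "('q, 'a, 's) tm"
  assumes M: "is_lba X M"
  shows "in_class CS X (lba_lang X M)"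
proof -
  have fin: "finite (tm_states M)" "finite (tm_work M)"
    using M by (auto simp: is_lba_def intro: finite_tm_states finite_tm_work)
  obtain h :: "'q \<Rightarrow> nat" where h: "inj_on h (tm_states M)" using fin(1) by (rule finite_inj_on_nat)
  obtain k :: "'s \<Rightarrow> nat" where k: "inj_on k (tm_work M)" using fin(2) by (rule finite_inj_on_nat)
  have tape: "map_symbol id k \<circ> lba_tape w = lba_tape w" for w :: "'a list"
    by (auto simp: lba_tape_def fun_eq_iff)
  have "tm_accepts (rename_tm h k M) (map_symbol id k \<circ> lba_tape w) \<longleftrightarrow> tm_accepts M (lba_tape w)"
    for w by (rule tm_accepts_rename[OF h k]) (auto simp: lba_tape_def)
  then have "lba_lang X M = lba_lang X (rename_tm h k M)" by (simp add: lba_lang_accepts tape)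
  moreover have "is_lba X (rename_tm h k M)"
    using M by (fastforce simp: is_lba_def rename_tm_def)
  ultimately show ?thesis by auto
qed

section \<open>Finite automata and pushdown automata on homomorphic images\<close>

abbreviation word_image :: "('a \<Rightarrow> 'b list) \<Rightarrow> 'a list \<Rightarrow> 'b list" where
  "word_image f w \<equiv> concat (map f w)"

text \<open>
  An automaton for the homomorphic image reads the image of a letter one symbol at a time. What it has
  read since the last simulated move is kept in its state, as a buffer; the useful buffers are the
  prefixes of images of letters, of which there are finitely many.
\<close>

definition buffers :: "('a \<Rightarrow> 'b list) \<Rightarrow> 'a set \<Rightarrow> 'b list set" where
  "buffers f X = (\<Union>x\<in>X. set (prefixes (f x)))"

lemma finite_buffers: "finite X \<Longrightarrow> finite (buffers f X)"
  by (simp add: buffers_def)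

lemma image_in_buffers: "x \<in> X \<Longrightarrow> f x \<in> buffers f X"
  by (auto simp: buffers_def)

lemma append_buffersD: "v @ u \<in> buffers f X \<Longrightarrow> v \<in> buffers f X"
  by (auto simp: buffers_def dest: append_prefixD)

lemma set_buffers: "u \<in> buffers f X \<Longrightarrow> (\<And>x. x \<in> X \<Longrightarrow> f x \<in> lists Y) \<Longrightarrow> set u \<subseteq> Y"
  by (fastforce simp: buffers_def dest: set_mono_prefix)

lemma last_buffer:
  assumes "u \<in> buffers f X - {[]}" "\<And>x. x \<in> X \<Longrightarrow> f x \<in> lists Y"
  shows "last u \<in> Y"
  using set_buffers[of u f X Y] assms last_in_set[of u] by blast

lemma word_image_lists: "(\<And>x. x \<in> X \<Longrightarrow> f x \<in> lists Y) \<Longrightarrow> w \<in> lists X \<Longrightarrow> word_image f w \<in> lists Y"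
  by fastforce

lemma opt_word_in_lists: "opt_word a \<in> lists X \<longleftrightarrow> set_option a \<subseteq> X"
  by (cases a) (auto simp: opt_word_def)

lemma word_image_opt_word_in_buffers:
  assumes "set_option a \<subseteq> X" "word_image f (opt_word a) \<noteq> []"
  shows "word_image f (opt_word a) \<in> buffers f X"
  using assms by (cases a) (auto simp: opt_word_def intro: image_in_buffers)

lemma is_fsa_input: "is_fsa X M \<Longrightarrow> (p, a, q) \<in> fsa_trans M \<Longrightarrow> set_option a \<subseteq> X"
  unfolding is_fsa_def by fast

lemma is_pda_input: "is_pda X M \<Longrightarrow> (p, a, Z, q, \<gamma>) \<in> pda_trans M \<Longrightarrow> set_option a \<subseteq> X"
  unfolding is_pda_def by fast

text \<open>
  The automaton either extends its buffer by the next input symbol, or performs a transition of \<open>M\<close>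
  reading \<open>a\<close> when the buffer is exactly the image of \<open>a\<close>. It never has to look for the boundaries
  between the images of successive letters: they are guessed by choosing when to empty the buffer.
\<close>

definition image_fsa ::
  "('a \<Rightarrow> 'b list) \<Rightarrow> 'a set \<Rightarrow> ('q, 'a) fsa \<Rightarrow> ('q \<times> 'b list, 'b) fsa" where
  "image_fsa f X M = \<lparr>fsa_init = (fsa_init M, []), fsa_final = (\<lambda>q. (q, [])) ` fsa_final M,
     fsa_trans =
       (\<lambda>((p, a, q), u). ((p, butlast u), Some (last u), (p, u))) `
         (fsa_trans M \<times> (buffers f X - {[]})) \<union>
       (\<lambda>(p, a, q). ((p, word_image f (opt_word a)), None, (q, []))) ` fsa_trans M\<rparr>"

lemma is_fsa_image:
  assumes "finite X" and f: "\<And>x. x \<in> X \<Longrightarrow> f x \<in> lists Y" and "is_fsa X M"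
  shows "is_fsa Y (image_fsa f X M)"
  using assms finite_buffers[OF assms(1), of f] last_buffer[of _ f X Y, OF _ f]
  by (auto simp: is_fsa_def image_fsa_def)

lemma image_fsa_fill_buffer:
  assumes "(p, a, q) \<in> fsa_trans M" "u \<noteq> [] \<Longrightarrow> v @ u \<in> buffers f X"
  shows "(fsa_step (image_fsa f X M))\<^sup>*\<^sup>* ((p, v), u @ r) ((p, v @ u), r)"
  using assms(2)
proof (induction u arbitrary: v)
  case (Cons y u)
  have "v @ [y] \<in> buffers f X" using Cons.prems append_buffersD[of "v @ [y]" u] by simp
  then have "((p, v), Some y, (p, v @ [y])) \<in> fsa_trans (image_fsa f X M)"
    using assms(1) by (force simp: image_fsa_def)
  then have "fsa_step (image_fsa f X M) ((p, v), (y # u) @ r) ((p, v @ [y]), u @ r)"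
    using fsa_step.intros[of _ "Some y"] by (force simp: opt_word_def)
  with Cons.IH[of "v @ [y]"] Cons.prems show ?case
    by (auto intro: converse_rtranclp_into_rtranclp)
qed simp

lemma image_fsa_step:
  assumes "fsa_step M (p, w) (q, w')" and M: "is_fsa X M"
  shows "(fsa_step (image_fsa f X M))\<^sup>*\<^sup>* ((p, []), word_image f w) ((q, []), word_image f w')"
  using assms(1)
proof cases
  case (1 a)
  let ?N = "image_fsa f X M" and ?u = "word_image f (opt_word a)"
  have "(fsa_step ?N)\<^sup>*\<^sup>* ((p, []), ?u @ word_image f w') ((p, [] @ ?u), word_image f w')"
    using 1(2) word_image_opt_word_in_buffers[OF is_fsa_input[OF M 1(2)], of f]
    by (intro image_fsa_fill_buffer) auto
  moreover have "((p, ?u), None, (q, [])) \<in> fsa_trans ?N" using 1 by (force simp: image_fsa_def)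
  then have "fsa_step ?N ((p, ?u), opt_word None @ word_image f w') ((q, []), word_image f w')"
    by (rule fsa_step.intros)
  ultimately show ?thesis using 1 by (simp add: opt_word_def)
qed

text \<open>
  The induction runs backwards from acceptance, because a preimage of the remaining input is determined
  only by the rest of the computation. Extending the buffer leaves \<open>v @ r\<close>, the buffer followed by the
  unread input, unchanged.
\<close>

lemma image_fsa_runs_preimage:
  assumes run: "(fsa_step (image_fsa f X M))\<^sup>*\<^sup>* ((p, v), r) ((q, []), [])" and M: "is_fsa X M"
  shows "\<exists>w\<in>lists X. v @ r = word_image f w \<and> (fsa_step M)\<^sup>*\<^sup>* (p, w) (q, [])"
  using run
proof (induction "((p, v), r)" arbitrary: p v r rule: converse_rtranclp_induct)
  case base
  then show ?case by force
next
  case (step c)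
  from step(1) obtain b p' v' r' where b: "((p, v), b, (p', v')) \<in> fsa_trans (image_fsa f X M)"
    "r = opt_word b @ r'" "c = ((p', v'), r')"
    by cases auto
  obtain w where w: "w \<in> lists X" "v' @ r' = word_image f w" "(fsa_step M)\<^sup>*\<^sup>* (p', w) (q, [])"
    using step(3)[OF b(3)] by auto
  from b(1) consider
    "p' = p" "v' \<noteq> []" "v = butlast v'" "b = Some (last v')"
    | a where "(p, a, p') \<in> fsa_trans M" "v = word_image f (opt_word a)" "b = None" "v' = []"
    by (auto simp: image_fsa_def)
  then show ?case
  proof cases
    case 1
    then have "v @ r = v' @ r'" using b(2) by (simp add: opt_word_def)
    then show ?thesis using w 1 by auto
  next
    case (2 a)
    have "fsa_step M (p, opt_word a @ w) (p', w)" by (rule fsa_step.intros) (rule 2)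
    then have "(fsa_step M)\<^sup>*\<^sup>* (p, opt_word a @ w) (q, [])"
      using w(3) by (rule converse_rtranclp_into_rtranclp)
    moreover have "opt_word a \<in> lists X"
      using is_fsa_input[OF M 2(1)] by (simp add: opt_word_in_lists)
    moreover have "v @ r = word_image f (opt_word a @ w)"
      using w(2) 2 b(2) by (simp add: opt_word_def[of None])
    ultimately show ?thesis
      using w(1) by (intro bexI[of _ "opt_word a @ w"]) auto
  qed
qed

lemma fsa_lang_image:
  assumes f: "\<And>x. x \<in> X \<Longrightarrow> f x \<in> lists Y" and M: "is_fsa X M"
  shows "fsa_lang Y (image_fsa f X M) = word_image f ` fsa_lang X M"
proof -
  let ?N = "image_fsa f X M"
  have runs: "(fsa_step ?N)\<^sup>*\<^sup>* ((p, []), word_image f w) ((q, []), [])"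
    if "(fsa_step M)\<^sup>*\<^sup>* (p, w) (q, [])" for p w q
    using that
  proof (induction "(p, w)" arbitrary: p w rule: converse_rtranclp_induct)
    case (step c)
    obtain p' w' where c: "c = (p', w')" by (cases c) auto
    show ?case
      using image_fsa_step[OF step(1)[unfolded c] M, of f] step(3)[OF c] by (rule rtranclp_trans)
  qed simp
  have im: "word_image f w \<in> lists Y" if "w \<in> lists X" for w
    using f that by (rule word_image_lists)
  have ini: "fsa_init ?N = (fsa_init M, [])" and fin: "fsa_final ?N = (\<lambda>q. (q, [])) ` fsa_final M"
    by (simp_all add: image_fsa_def)
  show ?thesis
    using runs im image_fsa_runs_preimage[OF _ M, of f _ "[]"]
    by (fastforce simp: fsa_lang_def ini fin)
qed

text \<open>
  Symbols are read before the stack is changed. The opposite order, in which a move of \<open>M\<close> is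
  performed first and the image of its letter is read afterwards, would fail when this move empties the
  stack, since a pushdown automaton with an empty stack cannot move. Reading into the buffer puts the
  top symbol \<open>Z\<close> back.
\<close>

definition image_pda ::
  "('a \<Rightarrow> 'b list) \<Rightarrow> 'a set \<Rightarrow> ('q, 'a, 's) pda \<Rightarrow> ('q \<times> 'b list, 'b, 's) pda" where
  "image_pda f X M = \<lparr>pda_init = (pda_init M, []), pda_bottom = pda_bottom M,
     pda_final = (\<lambda>q. (q, [])) ` pda_final M,
     pda_trans =
       (\<lambda>((p, a, Z, q, \<gamma>), u). ((p, butlast u), Some (last u), Z, (p, u), [Z])) `
         (pda_trans M \<times> (buffers f X - {[]})) \<union>
       (\<lambda>(p, a, Z, q, \<gamma>). ((p, word_image f (opt_word a)), None, Z, (q, []), \<gamma>)) ` pda_trans M\<rparr>"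

lemma is_pda_image:
  assumes "finite X" and f: "\<And>x. x \<in> X \<Longrightarrow> f x \<in> lists Y" and "is_pda X M"
  shows "is_pda Y (image_pda f X M)"
  using assms finite_buffers[OF assms(1), of f] last_buffer[of _ f X Y, OF _ f]
  by (auto simp: is_pda_def image_pda_def)

lemma image_pda_fill_buffer:
  assumes "(p, a, Z, q, \<gamma>) \<in> pda_trans M" "u \<noteq> [] \<Longrightarrow> v @ u \<in> buffers f X"
  shows "(pda_step (image_pda f X M))\<^sup>*\<^sup>* ((p, v), u @ r, Z # \<beta>) ((p, v @ u), r, Z # \<beta>)"
  using assms(2)
proof (induction u arbitrary: v)
  case (Cons y u)
  have "v @ [y] \<in> buffers f X" using Cons.prems append_buffersD[of "v @ [y]" u] by simp
  then have "((p, v), Some y, Z, (p, v @ [y]), [Z]) \<in> pda_trans (image_pda f X M)"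
    using assms(1) by (force simp: image_pda_def)
  then have "pda_step (image_pda f X M) ((p, v), (y # u) @ r, Z # \<beta>) ((p, v @ [y]), u @ r, Z # \<beta>)"
    using pda_step.intros[of _ "Some y" _ _ "[Z]"] by (force simp: opt_word_def)
  with Cons.IH[of "v @ [y]"] Cons.prems show ?case
    by (auto intro: converse_rtranclp_into_rtranclp)
qed simp

lemma image_pda_step:
  assumes "pda_step M (p, w, \<alpha>) (q, w', \<beta>)" and M: "is_pda X M"
  shows "(pda_step (image_pda f X M))\<^sup>*\<^sup>*
    ((p, []), word_image f w, \<alpha>) ((q, []), word_image f w', \<beta>)"
  using assms(1)
proof cases
  case (1 a Z \<gamma> \<delta>)
  let ?N = "image_pda f X M" and ?u = "word_image f (opt_word a)"
  have "(pda_step ?N)\<^sup>*\<^sup>* ((p, []), ?u @ word_image f w', Z # \<delta>)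
      ((p, [] @ ?u), word_image f w', Z # \<delta>)"
    using 1(4) word_image_opt_word_in_buffers[OF is_pda_input[OF M 1(4)], of f]
    by (intro image_pda_fill_buffer) auto
  moreover have "((p, ?u), None, Z, (q, []), \<gamma>) \<in> pda_trans ?N"
    using 1 by (force simp: image_pda_def)
  then have "pda_step ?N ((p, ?u), opt_word None @ word_image f w', Z # \<delta>)
      ((q, []), word_image f w', \<gamma> @ \<delta>)"
    by (rule pda_step.intros)
  ultimately show ?thesis using 1 by (simp add: opt_word_def)
qed

lemma image_pda_runs_preimage:
  assumes run: "(pda_step (image_pda f X M))\<^sup>*\<^sup>* ((p, v), r, \<alpha>) ((q, []), [], \<beta>)"
    and M: "is_pda X M"
  shows "\<exists>w\<in>lists X. v @ r = word_image f w \<and> (pda_step M)\<^sup>*\<^sup>* (p, w, \<alpha>) (q, [], \<beta>)"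
  using run
proof (induction "((p, v), r, \<alpha>)" arbitrary: p v r \<alpha> rule: converse_rtranclp_induct)
  case base
  then show ?case by force
next
  case (step c)
  from step(1) obtain b Z p' v' \<gamma> r' \<delta> where
    b: "((p, v), b, Z, (p', v'), \<gamma>) \<in> pda_trans (image_pda f X M)"
      "r = opt_word b @ r'" "c = ((p', v'), r', \<gamma> @ \<delta>)" "\<alpha> = Z # \<delta>"
    by cases auto
  obtain w where w: "w \<in> lists X" "v' @ r' = word_image f w"
    "(pda_step M)\<^sup>*\<^sup>* (p', w, \<gamma> @ \<delta>) (q, [], \<beta>)"
    using step(3)[OF b(3)] by auto
  from b(1) consider
    "p' = p" "v' \<noteq> []" "v = butlast v'" "b = Some (last v')" "\<gamma> = [Z]"
    | a where "(p, a, Z, p', \<gamma>) \<in> pda_trans M" "v = word_image f (opt_word a)" "b = None" "v' = []"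
    by (auto simp: image_pda_def)
  then show ?case
  proof cases
    case 1
    then have "v @ r = v' @ r'" using b(2) by (simp add: opt_word_def)
    then show ?thesis using w 1 b(4) by auto
  next
    case (2 a)
    have "pda_step M (p, opt_word a @ w, Z # \<delta>) (p', w, \<gamma> @ \<delta>)"
      by (rule pda_step.intros) (rule 2)
    then have "(pda_step M)\<^sup>*\<^sup>* (p, opt_word a @ w, Z # \<delta>) (q, [], \<beta>)"
      using w(3) by (rule converse_rtranclp_into_rtranclp)
    moreover have "opt_word a \<in> lists X"
      using is_pda_input[OF M 2(1)] by (simp add: opt_word_in_lists)
    moreover have "v @ r = word_image f (opt_word a @ w)"
      using w(2) 2 b(2) by (simp add: opt_word_def[of None])
    ultimately show ?thesis
      using w(1) b(4) by (intro bexI[of _ "opt_word a @ w"]) auto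
  qed
qed

lemma pda_lang_image:
  assumes f: "\<And>x. x \<in> X \<Longrightarrow> f x \<in> lists Y" and M: "is_pda X M"
  shows "pda_lang Y (image_pda f X M) = word_image f ` pda_lang X M"
proof -
  let ?N = "image_pda f X M"
  have runs: "(pda_step ?N)\<^sup>*\<^sup>* ((p, []), word_image f w, \<alpha>) ((q, []), [], \<beta>)"
    if "(pda_step M)\<^sup>*\<^sup>* (p, w, \<alpha>) (q, [], \<beta>)" for p w q \<alpha> \<beta>
    using that
  proof (induction "(p, w, \<alpha>)" arbitrary: p w \<alpha> rule: converse_rtranclp_induct)
    case (step c)
    obtain p' w' \<alpha>' where c: "c = (p', w', \<alpha>')" by (cases c) auto
    show ?case
      using image_pda_step[OF step(1)[unfolded c] M, of f] step(3)[OF c] by (rule rtranclp_trans)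
  qed simp
  have im: "word_image f w \<in> lists Y" if "w \<in> lists X" for w
    using f that by (rule word_image_lists)
  have ini: "pda_init ?N = (pda_init M, [])" and fin: "pda_final ?N = (\<lambda>q. (q, [])) ` pda_final M"
    and bot: "pda_bottom ?N = pda_bottom M"
    by (simp_all add: image_pda_def)
  show ?thesis
    using runs im image_pda_runs_preimage[OF _ M, of f _ "[]"]
    by (fastforce simp: pda_lang_def ini fin bot)
qed

section \<open>Turing machines on homomorphic images\<close>

text \<open>
  A Turing machine for the image of the language of \<open>M\<close> works in two stages. It first guesses a
  factorisation of its input into images of letters and records it in place: the block of cells holding
  \<open>f x\<close> becomes \<open>Skip, \<dots>, Skip, Letter x\<close>. Then it returns to the left end and simulates \<open>M\<close>, passing
  over every \<open>Skip\<close> it meets. Nothing is moved, so the same construction serves for linearly bounded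
  automata. A block needs one cell for its letter, which is why the images must be nonempty.

  Letters and work symbols of \<open>M\<close> both become work symbols, because letters of \<open>X\<close> need not belong to
  the new input alphabet.
\<close>

datatype ('a, 's) cell = Skip | Letter 'a | Aux 's

text \<open>
  \<open>Decode v\<close> has read \<open>v\<close> of the current block. \<open>Run q d\<close> represents the state \<open>q\<close> of \<open>M\<close> entered by a
  move in direction \<open>d\<close>, possibly with cells \<open>Skip\<close> still to be passed over in this direction. \<open>Start\<close>
  is used only to step off a left end marker.
\<close>

datatype ('q, 'b) state = Start | Decode "'b list" | Rewind | Run 'q move

fun enc :: "('a, 's) symbol \<Rightarrow> ('b, ('a, 's) cell) symbol" where
  "enc (Input x) = Work (Letter x)"
| "enc (Work s) = Work (Aux s)"
| "enc Blank = Blank"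
| "enc LeftEnd = LeftEnd"
| "enc RightEnd = RightEnd"

lemma enc_eq_iff [simp]: "enc s = enc t \<longleftrightarrow> s = t"
  by (cases s; cases t) auto

lemma enc_not_skip [simp]: "enc s \<noteq> Work Skip"
  by (cases s) auto

definition decoding_trans :: "('a \<Rightarrow> 'b list) \<Rightarrow> 'a set \<Rightarrow>
    (('q, 'b) state \<times> ('b, ('a, 's) cell) symbol \<times>
      ('q, 'b) state \<times> ('b, ('a, 's) cell) symbol \<times> move) set" where
  "decoding_trans f X =
     (\<lambda>u. (Decode (butlast u), Input (last u), Decode u, Work Skip, MoveRight)) `
       (buffers f X - {[]}) \<union>
     (\<lambda>x. (Decode (butlast (f x)), Input (last (f x)), Decode [], Work (Letter x), MoveRight)) ` X \<union>
     (\<lambda>s. (Rewind, Work s, Rewind, Work s, MoveLeft)) ` insert Skip (Letter ` X)"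

definition simulating_trans :: "('q, 'a, 's) tm \<Rightarrow> move \<Rightarrow>
    (('q, 'b) state \<times> ('b, ('a, 's) cell) symbol \<times>
      ('q, 'b) state \<times> ('b, ('a, 's) cell) symbol \<times> move) set" where
  "simulating_trans M e =
     insert (Run (tm_init M) e, Work Skip, Run (tm_init M) e, Work Skip, e)
       ((\<lambda>(p, s, q, t, d). (Run q d, Work Skip, Run q d, Work Skip, d)) ` tm_trans M) \<union>
     (\<lambda>((p, s, q, t, d), d'). (Run p d', enc s, Run q d, enc t, d)) ` (tm_trans M \<times> UNIV)"

text \<open>
  The symbols \<open>l\<close> and \<open>r\<close> are those that delimit the input on the left and on the right, and \<open>e\<close> is
  the move that leads from the cell scanning \<open>l\<close> to the position where \<open>M\<close> starts: to the right for
  Turing machines, which start on the first letter, and no move for linearly bounded automata, which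
  start on the left end marker.
\<close>

definition image_tm ::
  "('a \<Rightarrow> 'b list) \<Rightarrow> 'a set \<Rightarrow> ('q, 'a, 's) tm \<Rightarrow> ('q, 'b) state \<Rightarrow>
    ('b, ('a, 's) cell) symbol \<Rightarrow> ('b, ('a, 's) cell) symbol \<Rightarrow> move \<Rightarrow>
    (('q, 'b) state, 'b, ('a, 's) cell) tm" where
  "image_tm f X M i l r e = \<lparr>tm_init = i, tm_final = (\<lambda>(q, d). Run q d) ` (tm_final M \<times> UNIV),
     tm_trans = decoding_trans f X \<union> simulating_trans M e \<union>
       {(Start, l, Decode [], l, MoveRight), (Decode [], r, Rewind, r, MoveLeft),
        (Rewind, l, Run (tm_init M) e, l, e)}\<rparr>"

lemma finite_UNIV_move: "finite (UNIV :: move set)"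
proof -
  have "(UNIV :: move set) = {MoveLeft, Stay, MoveRight}" using move.exhaust by blast
  then show ?thesis by (metis finite.emptyI finite.insertI)
qed

lemma finite_image_tm:
  assumes "finite X" "finite (tm_final M)" "finite (tm_trans M)"
  shows "finite (tm_final (image_tm f X M i l r e))" "finite (tm_trans (image_tm f X M i l r e))"
  using assms finite_buffers[OF assms(1), of f] finite_UNIV_move
  by (auto simp: image_tm_def decoding_trans_def simulating_trans_def)

lemma is_tm_image:
  assumes "finite X" and f: "\<And>x. x \<in> X \<Longrightarrow> f x \<in> lists Y - {[]}" and M: "is_tm X M"
  shows "is_tm Y (image_tm f X M (Decode []) Blank Blank MoveRight)"
proof -
  have l1: "last u \<in> Y" if "u \<in> buffers f X - {[]}" for u
    using last_buffer[OF that, of Y] f by blast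
  have l2: "last (f x) \<in> Y" if "x \<in> X" for x
    using f[OF that] last_in_set[of "f x"] by auto
  have e: "enc s \<in> Input ` Y \<union> range Work \<union> {Blank}"
    if "s \<in> Input ` X \<union> range Work \<union> {Blank}" for s :: "('a, 'd) symbol"
    using that by auto
  have "{s, t} \<subseteq> Input ` Y \<union> range Work \<union> {Blank}"
    if "(p, s, q, t, d) \<in> tm_trans (image_tm f X M (Decode []) Blank Blank MoveRight)" for p s q t d
    using that M l1 l2 e
    by (fastforce simp: image_tm_def decoding_trans_def simulating_trans_def is_tm_def)
  then show ?thesis
    using finite_image_tm[OF assms(1), of M] M by (fastforce simp: is_tm_def)
qed

lemma is_lba_image:
  assumes "finite X" and f: "\<And>x. x \<in> X \<Longrightarrow> f x \<in> lists Y - {[]}" and M: "is_lba X M"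
  shows "is_lba Y (image_tm f X M Start LeftEnd RightEnd Stay)"
proof -
  have l1: "last u \<in> Y" if "u \<in> buffers f X - {[]}" for u
    using last_buffer[OF that, of Y] f by blast
  have l2: "last (f x) \<in> Y" if "x \<in> X" for x
    using f[OF that] last_in_set[of "f x"] by auto
  have "{s, t} \<subseteq> Input ` Y \<union> range Work \<or>
        s = LeftEnd \<and> t = LeftEnd \<and> d \<noteq> MoveLeft \<or>
        s = RightEnd \<and> t = RightEnd \<and> d \<noteq> MoveRight"
    if "(p, s, q, t, d) \<in> tm_trans (image_tm f X M Start LeftEnd RightEnd Stay)" for p s q t d
    using that M l1 l2
    by (fastforce simp: image_tm_def decoding_trans_def simulating_trans_def is_lba_def)
  then show ?thesis
    using finite_image_tm[OF assms(1), of M] M by (fastforce simp: is_lba_def)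
qed

subsection \<open>Simulation on a stretched tape\<close>

text \<open>
  Here \<open>p i\<close> is the position of the cell that represents cell \<open>i\<close> of the tape of \<open>M\<close>.
\<close>

definition stretches ::
  "(int \<Rightarrow> int) \<Rightarrow> (int \<Rightarrow> ('a, 's) symbol) \<Rightarrow> (int \<Rightarrow> ('b, ('a, 's) cell) symbol) \<Rightarrow> bool" where
  "stretches p T T' \<longleftrightarrow> (\<forall>i. T' (p i) = enc (T i)) \<and> (\<forall>j. j \<notin> range p \<longrightarrow> T' j = Work Skip)"

text \<open>
  The positions at which the simulating head may be after a move of \<open>M\<close> in direction \<open>d\<close> to cell \<open>i\<close>:
  having left the representative of the previous cell, it is on its way to that of \<open>i\<close> or there.
\<close>

definition on_way :: "(int \<Rightarrow> int) \<Rightarrow> move \<Rightarrow> int \<Rightarrow> int \<Rightarrow> bool" where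
  "on_way p d i j \<longleftrightarrow> (case d of
     MoveLeft \<Rightarrow> p i \<le> j \<and> j < p (i + 1)
   | Stay \<Rightarrow> j = p i
   | MoveRight \<Rightarrow> p (i - 1) < j \<and> j \<le> p i)"

lemma stretches_upd:
  assumes "strict_mono p" "stretches p T T'"
  shows "stretches p (T(i := t)) (T'(p i := enc t))"
proof -
  have "p j = p i \<longleftrightarrow> j = i" for j using assms(1) by (simp add: strict_mono_eq)
  then show ?thesis using assms(2) by (auto simp: stretches_def)
qed

lemma on_way_step: "strict_mono p \<Longrightarrow> on_way p d (i + shift d) (p i + shift d)"
  using strict_monoD[of p i "i + 1"] strict_monoD[of p "i - 1" i]
  by (auto simp: on_way_def split: move.split)

lemma on_way_hit:
  assumes "strict_mono p" "on_way p d i (p k)"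
  shows "k = i"
  using assms by (auto simp: on_way_def strict_mono_less strict_mono_less_eq strict_mono_eq
      split: move.splits)

lemma on_way_skip: "on_way p d i j \<Longrightarrow> j \<noteq> p i \<Longrightarrow> on_way p d i (j + shift d)"
  by (auto simp: on_way_def split: move.splits)

inductive tracks ::
  "(int \<Rightarrow> int) \<Rightarrow> 'q \<times> int \<times> (int \<Rightarrow> ('a, 's) symbol) \<Rightarrow>
     ('q, 'b) state \<times> int \<times> (int \<Rightarrow> ('b, ('a, 's) cell) symbol) \<Rightarrow> bool"
  for p where
  "stretches p T T' \<Longrightarrow> on_way p d i j \<Longrightarrow> tracks p (q, i, T) (Run q d, j, T')"

lemma image_tm_Run_trans:
  "(Run q d, s, z) \<in> tm_trans (image_tm f X M i l r e) \<longleftrightarrow> (Run q d, s, z) \<in> simulating_trans M e"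
  by (auto simp: image_tm_def decoding_trans_def)

text \<open>
  A step of the simulating machine either passes over a cell \<open>Skip\<close>, to which no step of \<open>M\<close>
  corresponds, or happens on the representative of the cell scanned by \<open>M\<close>: no other representative is
  on the way.
\<close>

lemma tracks_backward:
  assumes p: "strict_mono p" and "tm_step (image_tm f X M i0 l r e) c' d'" and "tracks p c c'"
  shows "\<exists>d. (tm_step M)\<^sup>*\<^sup>* c d \<and> tracks p d d'"
  using assms(3)
proof cases
  case (1 T T' d i j q)
  obtain z t a where tr: "(Run q d, T' j, z, t, a) \<in> simulating_trans M e"
    and d': "d' = (z, j + shift a, T'(j := t))"
    using assms(2) 1(2) by cases (auto simp: image_tm_Run_trans)
  from tr consider
    "T' j = Work Skip" "z = Run q d" "t = Work Skip" "a = d"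
    | s q' t' where "(q, s, q', t', a) \<in> tm_trans M" "T' j = enc s" "z = Run q' a" "t = enc t'"
    unfolding simulating_trans_def by fastforce
  then show ?thesis
  proof cases
    case 1: 1
    have "j \<noteq> p i" using 1(1) \<open>stretches p T T'\<close> by (metis stretches_def enc_not_skip)
    then have "on_way p d i (j + shift d)" using \<open>on_way p d i j\<close> by (rule on_way_skip[rotated])
    moreover have "T'(j := t) = T'" using 1 by auto
    ultimately have "tracks p c d'"
      using \<open>c = _\<close> d' 1 \<open>stretches p T T'\<close> by (auto intro: tracks.intros)
    then show ?thesis by blast
  next
    case 2: (2 s q' t')
    have "j \<in> range p" using 2(2) \<open>stretches p T T'\<close> by (metis stretches_def enc_not_skip)
    then have j: "j = p i" using on_way_hit[OF p] \<open>on_way p d i j\<close> by auto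
    then have "T i = s" using 2(2) \<open>stretches p T T'\<close> by (simp add: stretches_def)
    then have "tm_step M c (q', i + shift a, T(i := t'))"
      using \<open>c = _\<close> 2(1) by (auto intro: tm_step.intros)
    moreover have "tracks p (q', i + shift a, T(i := t')) d'"
      unfolding d' 2(3,4) j
      by (rule tracks.intros) (simp_all add: stretches_upd on_way_step p \<open>stretches p T T'\<close>)
    ultimately show ?thesis by blast
  qed
qed

lemma image_tm_skip:
  assumes p: "strict_mono p" and T: "stretches p T T'" and "on_way p d i j"
    and tr: "(Run q d, Work Skip, Run q d, Work Skip, d) \<in> tm_trans (image_tm f X M i0 l r e)"
  shows "(tm_step (image_tm f X M i0 l r e))\<^sup>*\<^sup>* (Run q d, j, T') (Run q d, p i, T')"
  using assms(3)
proof (induction "nat \<bar>p i - j\<bar>" arbitrary: j rule: less_induct)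
  case less
  show ?case
  proof (cases "j = p i")
    case False
    have "j \<notin> range p" using False less.prems on_way_hit[OF p] by auto
    then have s: "T' j = Work Skip" using T by (simp add: stretches_def)
    have "(Run q d, T' j, Run q d, Work Skip, d) \<in> tm_trans (image_tm f X M i0 l r e)"
      using tr s by simp
    from tm_step.intros[where h = j and tape = T', OF this]
    have "tm_step (image_tm f X M i0 l r e) (Run q d, j, T') (Run q d, j + shift d, T')"
      using s by (metis fun_upd_triv)
    moreover have "nat \<bar>p i - (j + shift d)\<bar> < nat \<bar>p i - j\<bar>"
      using less.prems False by (auto simp: on_way_def split: move.splits)
    ultimately show ?thesis
      using less.hyps[OF _ on_way_skip[OF less.prems False]]
      by (auto intro: converse_rtranclp_into_rtranclp)
  qed simp
qed

text \<open>
  To follow a computation of \<open>M\<close> it is enough to consider the moments at which the simulating head has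
  arrived at its destination.
\<close>

inductive tracks_settled ::
  "(int \<Rightarrow> int) \<Rightarrow> 'q \<times> int \<times> (int \<Rightarrow> ('a, 's) symbol) \<Rightarrow>
     ('q, 'b) state \<times> int \<times> (int \<Rightarrow> ('b, ('a, 's) cell) symbol) \<Rightarrow> bool"
  for p where
  "stretches p T T' \<Longrightarrow> tracks_settled p (q, i, T) (Run q d, p i, T')"

lemma tracks_forward:
  assumes p: "strict_mono p" and "tm_step M c d" and "tracks_settled p c c'"
  shows "\<exists>d'. (tm_step (image_tm f X M i0 l r e))\<^sup>*\<^sup>* c' d' \<and> tracks_settled p d d'"
  using assms(3)
proof cases
  case (1 T T' q i a)
  obtain q' t b where tr: "(q, T i, q', t, b) \<in> tm_trans M" "d = (q', i + shift b, T(i := t))"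
    using assms(2) 1(1) by cases auto
  let ?N = "image_tm f X M i0 l r e" and ?T = "T'(p i := enc t)"
  have "(Run q a, enc (T i), Run q' b, enc t, b) \<in> simulating_trans M e"
    using tr(1) by (force simp: simulating_trans_def)
  then have "(Run q a, T' (p i), Run q' b, enc t, b) \<in> tm_trans ?N"
    using 1(3) by (simp add: image_tm_Run_trans stretches_def)
  then have "tm_step ?N c' (Run q' b, p i + shift b, ?T)"
    unfolding 1(2) by (rule tm_step.intros)
  moreover have st: "stretches p (T(i := t)) ?T" using stretches_upd[OF p 1(3)] .
  moreover have "(Run q' b, Work Skip, Run q' b, Work Skip, b) \<in> tm_trans ?N"
    using tr(1) by (force simp: image_tm_Run_trans simulating_trans_def)
  from image_tm_skip[OF p st on_way_step[OF p] this]
  have "(tm_step ?N)\<^sup>*\<^sup>* (Run q' b, p i + shift b, ?T) (Run q' b, p (i + shift b), ?T)" .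
  moreover have "tracks_settled p d (Run q' b, p (i + shift b), ?T)"
    unfolding tr(2) by (rule tracks_settled.intros) (rule st)
  ultimately show ?thesis by (meson converse_rtranclp_into_rtranclp)
qed

subsection \<open>Tapes with a finite word between two half-lines\<close>

text \<open>
  The word \<open>cs\<close> occupies the cells from \<open>org\<close> on; \<open>L\<close> gives the cells to its left by their absolute
  position, and \<open>R\<close> those to its right by their distance from its end. This covers both the tapes of
  Turing machines and those of linearly bounded automata.
\<close>

definition frame :: "(int \<Rightarrow> 'c) \<Rightarrow> (int \<Rightarrow> 'c) \<Rightarrow> int \<Rightarrow> 'c list \<Rightarrow> int \<Rightarrow> 'c" where
  "frame L R org cs i =
     (if i < org then L i
      else if i < org + int (length cs) then cs ! nat (i - org)
      else R (i - org - int (length cs)))"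

lemma frame_head: "frame L R org (as @ s # bs) (org + int (length as)) = s"
  by (simp add: frame_def)

lemma frame_upd:
  "(frame L R org (as @ s # bs))(org + int (length as) := t) = frame L R org (as @ t # bs)"
proof
  fix i
  have "nat (i - org) \<noteq> length as" if "i \<noteq> org + int (length as)" "\<not> i < org" using that by auto
  then show "((frame L R org (as @ s # bs))(org + int (length as) := t)) i = frame L R org (as @ t # bs) i"
    by (auto simp: frame_def nth_append nth_Cons')
qed

lemma frame_left: "frame L R org cs (org - 1) = L (org - 1)"
  by (simp add: frame_def)

lemma frame_right: "frame L R org cs (org + int (length cs)) = R 0"
  by (simp add: frame_def)

lemma tm_tape_frame: "tm_tape w = frame (\<lambda>_. Blank) (\<lambda>_. Blank) 0 (map Input w)"
  by (auto simp: fun_eq_iff tm_tape_def frame_def)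

lemma lba_tape_frame:
  "lba_tape w = frame (\<lambda>i. if i = 0 then LeftEnd else Blank)
     (\<lambda>i. if i = 0 then RightEnd else Blank) 1 (map Input w)"
  by (auto simp: fun_eq_iff lba_tape_def frame_def)

definition block :: "('a \<Rightarrow> 'b list) \<Rightarrow> 'a \<Rightarrow> ('a, 's) cell list" where
  "block f x = replicate (length (f x) - 1) Skip @ [Letter x]"

abbreviation blocks :: "('a \<Rightarrow> 'b list) \<Rightarrow> 'a list \<Rightarrow> ('a, 's) cell list" where
  "blocks f \<equiv> word_image (block f)"

text \<open>
  The number of cells \<open>Skip\<close> in the blocks of \<open>w\<close>, by which these are longer than \<open>w\<close>.
\<close>

definition excess :: "('a \<Rightarrow> 'b list) \<Rightarrow> 'a list \<Rightarrow> nat" where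
  "excess f w = (\<Sum>x\<leftarrow>w. length (f x) - 1)"

lemma length_blocks: "length (blocks f w) = length w + excess f w"
  by (induction w) (simp_all add: block_def excess_def)

text \<open>
  Cell \<open>i\<close> is shifted by the cells \<open>Skip\<close> of all blocks up to and including its own, since a block
  carries its letter in its last cell. Cells left of the word stay where they are, and those right of it
  are all shifted by the full excess.
\<close>

definition letter_pos :: "('a \<Rightarrow> 'b list) \<Rightarrow> int \<Rightarrow> 'a list \<Rightarrow> int \<Rightarrow> int" where
  "letter_pos f org w i = i + int (excess f (take (nat (i - org + 1)) w))"

lemma strict_mono_letter_pos: "strict_mono (letter_pos f org w)"
proof (rule strict_monoI)
  fix i j :: int assume "i < j"
  define a b where "a = nat (i - org + 1)" and "b = nat (j - org + 1)"
  have "take b w = take a w @ drop a (take b w)"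
    using \<open>i < j\<close> append_take_drop_id[of a "take b w"] by (simp add: a_def b_def min_def split: if_splits)
  then have "excess f (take b w) = excess f (take a w) + excess f (drop a (take b w))"
    unfolding excess_def by (metis map_append sum_list_append)
  then show "letter_pos f org w i < letter_pos f org w j"
    using \<open>i < j\<close> by (simp add: letter_pos_def a_def b_def)
qed

text \<open>
  The cells of the blocks that are not \<open>Skip\<close> are at the positions given by \<open>letter_pos\<close>, here
  counted from the first block.
\<close>

lemma blocks_nth:
  fixes f :: "'a \<Rightarrow> 'b list"
  shows "m < length (blocks f w :: ('a, 's) cell list) \<Longrightarrow>
     (blocks f w :: ('a, 's) cell list) ! m = Skip \<or> (\<exists>k<length w. m = k + excess f (take (Suc k) w))"
proof (induction w arbitrary: m)
  case (Cons x w)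
  show ?case
  proof (cases "m < length (f x)")
    case True
    then have "(blocks f (x # w) :: ('a, 's) cell list) ! m = Skip \<or> m = length (f x) - 1"
      by (auto simp: block_def nth_append)
    then show ?thesis by (auto simp: excess_def intro!: exI[of _ 0])
  next
    case False
    define n where "n = m - length (block f x :: ('a, 's) cell list)"
    show ?thesis
    proof (cases "m < length (block f x :: ('a, 's) cell list)")
      case True
      then have "m < length (f x) - 1 + 1" by (simp add: block_def)
      then have "m = 0" "length (f x) = 0" using False by arith+
      then show ?thesis by (auto simp: excess_def intro!: exI[of _ 0])
    next
      case False
      then have m: "m = length (block f x :: ('a, 's) cell list) + n" by (simp add: n_def)
      have "(blocks f (x # w) :: ('a, 's) cell list) ! m = blocks f w ! n" by (simp add: m nth_append)
      moreover have "n < length (blocks f w :: ('a, 's) cell list)" using Cons.prems m by simp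
      then have "(blocks f w :: ('a, 's) cell list) ! n = Skip \<or> (\<exists>k<length w. n = k + excess f (take (Suc k) w))"
        by (rule Cons.IH)
      moreover have "\<exists>k'<length (x # w). m = k' + excess f (take (Suc k') (x # w))"
        if "k < length w" "n = k + excess f (take (Suc k) w)" for k
        using that m by (intro exI[of _ "Suc k"]) (auto simp: excess_def block_def)
      ultimately show ?thesis by auto
    qed
  qed
qed simp

lemma stretches_blocks:
  fixes f :: "'a \<Rightarrow> 'b list" and L R :: "int \<Rightarrow> ('a, 's) symbol"
  shows "stretches (letter_pos f org w) (frame L R org (map Input w))
     (frame (enc \<circ> L) (enc \<circ> R) org (map Work (blocks f w)))"
  unfolding stretches_def
proof (intro conjI allI impI)
  let ?p = "letter_pos f org w" and ?T' = "frame (enc \<circ> L) (enc \<circ> R) org (map Work (blocks f w))"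
  fix i
  have "\<exists>k. i = org + int k \<and> k < length w" if "\<not> i < org" "\<not> i \<ge> org + int (length w)"
    using that by (intro exI[of _ "nat (i - org)"]) auto
  then consider "i < org" | k where "i = org + int k" "k < length w" | "i \<ge> org + int (length w)"
    by blast
  then show "?T' (?p i) = enc (frame L R org (map Input w) i)"
  proof cases
    case 1
    then show ?thesis by (simp add: frame_def letter_pos_def excess_def)
  next
    case (2 k)
    define as :: "('a, 's) cell list" where "as = blocks f (take k w) @ replicate (length (f (w ! k)) - 1) Skip"
    have w: "w = take k w @ w ! k # drop (Suc k) w" using 2(2) by (rule id_take_nth_drop)
    have "blocks f w = as @ Letter (w ! k) # blocks f (drop (Suc k) w)"
      by (subst w) (simp add: as_def block_def)
    moreover have "?p i = org + int (length (map Work as))"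
      using 2 by (simp add: letter_pos_def as_def length_blocks take_Suc_conv_app_nth excess_def nat_add_distrib)
    ultimately have "?T' (?p i) = Work (Letter (w ! k))"
      using frame_head[of "enc \<circ> L" "enc \<circ> R" org "map Work as"] by simp
    then show ?thesis using 2 by (simp add: frame_def)
  next
    case 3
    let ?n = "int (length (blocks f w :: ('a, 's) cell list))"
    have eq: "?p i - org - ?n = i - org - int (length w)" and "?p i \<ge> org + ?n"
      using 3 by (simp_all add: letter_pos_def length_blocks)
    then have "?T' (?p i) = enc (R (?p i - org - ?n))" by (simp add: frame_def)
    then show ?thesis unfolding eq using 3 by (simp add: frame_def)
  qed
next
  let ?p = "letter_pos f org w" and ?T' = "frame (enc \<circ> L) (enc \<circ> R) org (map Work (blocks f w))"
  fix j assume j: "j \<notin> range ?p"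
  have lo: "\<not> j < org"
  proof
    assume "j < org"
    then have "?p j = j" by (simp add: letter_pos_def excess_def)
    then show False using j by (metis rangeI)
  qed
  have hi: "\<not> org + int (length (blocks f w :: ('a, 's) cell list)) \<le> j"
  proof
    assume "org + int (length (blocks f w :: ('a, 's) cell list)) \<le> j"
    then have "?p (j - int (excess f w)) = j" by (simp add: letter_pos_def length_blocks)
    then show False using j by (metis rangeI)
  qed
  have m: "j = org + int (nat (j - org))" "nat (j - org) < length (blocks f w :: ('a, 's) cell list)" using lo hi by auto
  have "nat (j - org) \<noteq> k + excess f (take (Suc k) w)" if "k < length w" for k
  proof
    assume "nat (j - org) = k + excess f (take (Suc k) w)"
    then have "?p (org + int k) = j" using m(1) by (simp add: letter_pos_def nat_add_distrib)
    then show False using j by (metis rangeI)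
  qed
  then have "(blocks f w :: ('a, 's) cell list) ! nat (j - org) = Skip" using blocks_nth[OF m(2)] by blast
  then show "?T' j = Work Skip" using lo hi by (simp add: frame_def)
qed

subsection \<open>Decoding the input\<close>

text \<open>
  The common situation of Turing machines (\<open>org = 0\<close>, all outside cells blank) and of linearly bounded
  automata (\<open>org = 1\<close>, end markers in the neighbouring cells). The tape of \<open>M\<close> has the outside cells
  \<open>L\<close> and \<open>R\<close>, that of the machine for the image has the corresponding cells \<open>L'\<close> and \<open>R'\<close>. That \<open>l\<close>
  and \<open>r\<close> are neither input nor work symbols lets the machine recognise the ends of its input.
\<close>

locale framed_image =
  fixes f :: "'a \<Rightarrow> 'b list" and X :: "'a set" and M :: "('q, 'a, 's) tm"
    and L R :: "int \<Rightarrow> ('a, 's) symbol"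
    and L' R' :: "int \<Rightarrow> ('b, ('a, 's) cell) symbol"
    and org :: int
    and i0 :: "('q, 'b) state" and l r :: "('b, ('a, 's) cell) symbol" and e :: move
  assumes nonempty: "x \<in> X \<Longrightarrow> f x \<noteq> []"
    and outside: "enc \<circ> L = L'" "enc \<circ> R = R'"
    and left: "L' (org - 1) = l" "l \<notin> range Input \<union> range Work"
    and right: "R' 0 = r" "r \<notin> range Input \<union> range Work"
    and start: "i0 = Decode [] \<and> org = 0 \<or> i0 = Start \<and> org = 1"
    and to_origin: "org - 1 + shift e = 0"
begin

abbreviation N where "N \<equiv> image_tm f X M i0 l r e"

abbreviation tape :: "('a, 's) symbol list \<Rightarrow> int \<Rightarrow> ('a, 's) symbol" where
  "tape \<equiv> frame L R org"

abbreviation tape' ::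
  "('b, ('a, 's) cell) symbol list \<Rightarrow> int \<Rightarrow> ('b, ('a, 's) cell) symbol" where
  "tape' \<equiv> frame L' R' org"

lemma Start_trans: "(Start, s, z) \<in> tm_trans N \<longleftrightarrow> s = l \<and> z = (Decode [], l, MoveRight)"
  by (auto simp: image_tm_def decoding_trans_def simulating_trans_def)

lemma Decode_trans: "(Decode v, s, z) \<in> tm_trans N \<longleftrightarrow>
    (\<exists>y. s = Input y \<and> v @ [y] \<in> buffers f X \<and> z = (Decode (v @ [y]), Work Skip, MoveRight)) \<or>
    (\<exists>y. \<exists>x\<in>X. s = Input y \<and> v @ [y] = f x \<and> z = (Decode [], Work (Letter x), MoveRight)) \<or>
    s = r \<and> v = [] \<and> z = (Rewind, r, MoveLeft)" (is "?A \<longleftrightarrow> ?B \<or> ?C \<or> ?D")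
proof -
  have "?A \<longleftrightarrow>
      (\<exists>u\<in>buffers f X - {[]}. v = butlast u \<and> s = Input (last u) \<and> z = (Decode u, Work Skip, MoveRight)) \<or>
      (\<exists>x\<in>X. v = butlast (f x) \<and> s = Input (last (f x)) \<and> z = (Decode [], Work (Letter x), MoveRight)) \<or>
      ?D" (is "_ \<longleftrightarrow> ?B' \<or> ?C' \<or> _")
    by (auto simp: image_tm_def decoding_trans_def simulating_trans_def)
  moreover have "?B' \<longleftrightarrow> ?B"
  proof
    assume ?B'
    then show ?B by (metis DiffE append_butlast_last_id singletonI)
  next
    assume ?B
    then show ?B' by force
  qed
  moreover have "?C' \<longleftrightarrow> ?C"
  proof
    assume ?C'
    then obtain x where x: "x \<in> X" "v = butlast (f x)" "s = Input (last (f x))"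
      "z = (Decode [], Work (Letter x), MoveRight)" by blast
    then have "v @ [last (f x)] = f x" using nonempty by simp
    then show ?C using x by blast
  next
    assume ?C
    then obtain y x where x: "x \<in> X" "v @ [y] = f x" "s = Input y"
      "z = (Decode [], Work (Letter x), MoveRight)" by blast
    then have "v = butlast (f x)" "y = last (f x)" by (metis butlast_snoc, metis last_snoc)
    then show ?C' using x by blast
  qed
  ultimately show ?thesis by simp
qed

lemma Rewind_trans: "(Rewind, s, z) \<in> tm_trans N \<longleftrightarrow>
    (\<exists>c\<in>insert Skip (Letter ` X). s = Work c \<and> z = (Rewind, Work c, MoveLeft)) \<or>
    s = l \<and> z = (Run (tm_init M) e, l, e)"
  by (auto simp: image_tm_def decoding_trans_def simulating_trans_def)

lemma read_step:
  assumes "(q, s, q', t, MoveRight) \<in> tm_trans N"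
  shows "tm_step N (q, org + int (length as), tape' (as @ s # bs))
    (q', org + int (length (as @ [t])), tape' ((as @ [t]) @ bs))"
  using tm_step.intros[where M = N and h = "org + int (length as)" and tape = "tape' (as @ s # bs)"
      and p = q and q = q' and t = t and d = MoveRight] assms
  by (simp add: frame_head frame_upd ac_simps)

lemma decode_letter:
  assumes "x \<in> X"
  shows "(tm_step N)\<^sup>*\<^sup>* (Decode [], org + int (length as), tape' (as @ map Input (f x) @ bs))
    (Decode [], org + int (length (as @ map Work (block f x))), tape' ((as @ map Work (block f x)) @ bs))"
proof -
  define u y where "u = butlast (f x)" and "y = last (f x)"
  have fx: "f x = u @ [y]" using nonempty[OF assms] by (simp add: u_def y_def)
  have prefix: "(tm_step N)\<^sup>*\<^sup>* (Decode v, org + int (length as), tape' (as @ map Input u @ bs))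
      (Decode (v @ u), org + int (length (as @ replicate (length u) (Work Skip))),
       tape' ((as @ replicate (length u) (Work Skip)) @ bs))"
    if "v @ u \<in> buffers f X" for u v as bs
    using that
  proof (induction u arbitrary: v as)
    case (Cons y u)
    have "v @ [y] \<in> buffers f X" using Cons.prems append_buffersD[of "v @ [y]" u] by simp
    then have "(Decode v, Input y, Decode (v @ [y]), Work Skip, MoveRight) \<in> tm_trans N"
      by (auto simp: Decode_trans)
    from read_step[OF this, of as "map Input u @ bs"] Cons.IH[of "v @ [y]" "as @ [Work Skip]"]
    show ?case using Cons.prems
      by (simp add: converse_rtranclp_into_rtranclp del: split_paired_All split_paired_Ex)
  qed simp
  have "[] @ u \<in> buffers f X"
    using image_in_buffers[OF assms, of f] append_buffersD[of u "[y]"] fx by simp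
  note prefix[OF this, of as "Input y # bs"]
  moreover have "(Decode u, Input y, Decode [], Work (Letter x), MoveRight) \<in> tm_trans N"
    using assms fx by (auto simp: Decode_trans)
  note read_step[OF this, of "as @ replicate (length u) (Work Skip)" bs]
  ultimately show ?thesis by (simp add: fx block_def)
qed

lemma decode_word:
  assumes "w \<in> lists X"
  shows "(tm_step N)\<^sup>*\<^sup>* (Decode [], org + int (length as), tape' (as @ map Input (word_image f w)))
    (Decode [], org + int (length (as @ map Work (blocks f w))), tape' (as @ map Work (blocks f w)))"
  using assms
proof (induction w arbitrary: as)
  case (Cons x w)
  from rtranclp_trans[OF decode_letter[OF Cons.hyps(1), of as "map Input (word_image f w)"]
      Cons.IH[of "as @ map Work (block f x)"]]
  show ?case by simp
qed simp

lemma rewind: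
  assumes "n \<le> length cs" "set cs \<subseteq> insert Skip (Letter ` X)"
  shows "(tm_step N)\<^sup>*\<^sup>* (Rewind, org - 1 + int n, tape' (map Work cs)) (Rewind, org - 1, tape' (map Work cs))"
  using assms(1)
proof (induction n)
  case (Suc n)
  define T where "T = tape' (map Work cs)"
  have h: "T (org - 1 + int (Suc n)) = Work (cs ! n)" using Suc.prems by (simp add: T_def frame_def)
  have "(Rewind, Work (cs ! n), Rewind, Work (cs ! n), MoveLeft) \<in> tm_trans N"
    using assms(2) Suc.prems nth_mem[of n cs] unfolding Rewind_trans by fastforce
  then have "tm_step N (Rewind, org - 1 + int (Suc n), T) (Rewind, org - 1 + int n, T)"
    using tm_step.intros[where M = N and h = "org - 1 + int (Suc n)" and tape = T and p = Rewind
        and q = Rewind and t = "Work (cs ! n)" and d = MoveLeft] h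
    by (simp add: fun_upd_idem algebra_simps)
  then show ?case using Suc unfolding T_def by (auto intro: converse_rtranclp_into_rtranclp)
qed simp

lemma set_blocks: "w \<in> lists X \<Longrightarrow> set (blocks f w) \<subseteq> insert Skip (Letter ` X)"
  by (fastforce simp: block_def)

lemma decodes:
  assumes w: "w \<in> lists X"
  shows "(tm_step N)\<^sup>*\<^sup>* (i0, 0, tape' (map Input (word_image f w)))
    (Run (tm_init M) e, 0, tape' (map Work (blocks f w)))"
proof -
  let ?T = "tape' (map Input (word_image f w))" and ?E = "tape' (map Work (blocks f w))"
  have "(tm_step N)\<^sup>*\<^sup>* (i0, 0, ?T) (Decode [], org, ?T)"
    using start
  proof
    assume s: "i0 = Start \<and> org = 1"
    have h: "?T 0 = l" using s left(1) by (simp add: frame_def)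
    have "(Start, ?T 0, Decode [], l, MoveRight) \<in> tm_trans N" by (simp add: h Start_trans)
    from tm_step.intros[where tape = "?T", OF this] have "tm_step N (Start, 0, ?T) (Decode [], 1, ?T)"
      using h by (simp add: fun_upd_idem)
    then show ?thesis using s by (metis r_into_rtranclp)
  qed simp
  also have "(tm_step N)\<^sup>*\<^sup>* \<dots> (Decode [], org + int (length (blocks f w :: ('a, 's) cell list)), ?E)"
    using decode_word[OF w, of "[]"] by simp
  also have "tm_step N \<dots> (Rewind, org - 1 + int (length (blocks f w :: ('a, 's) cell list)), ?E)"
  proof -
    have h: "?E (org + int (length (blocks f w :: ('a, 's) cell list))) = r"
      using frame_right[of L' R' org "map Work (blocks f w)"] right by simp
    have "(Decode [], ?E (org + int (length (blocks f w :: ('a, 's) cell list))), Rewind, r, MoveLeft) \<in> tm_trans N"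
      by (simp add: h Decode_trans)
    from tm_step.intros[where tape = "?E", OF this] show ?thesis
      using h by (simp add: fun_upd_idem algebra_simps)
  qed
  also have "(tm_step N)\<^sup>*\<^sup>* \<dots> (Rewind, org - 1, ?E)"
    using rewind[OF le_refl set_blocks[OF w]] .
  also have "tm_step N \<dots> (Run (tm_init M) e, 0, ?E)"
  proof -
    have h: "?E (org - 1) = l" using left by (simp add: frame_left)
    have "(Rewind, ?E (org - 1), Run (tm_init M) e, l, e) \<in> tm_trans N" by (simp add: h Rewind_trans)
    from tm_step.intros[where tape = "?E", OF this] show ?thesis
      using h to_origin by (simp add: fun_upd_idem)
  qed
  finally show ?thesis .
qed

lemma stretches_tape: "stretches (letter_pos f org w) (tape (map Input w)) (tape' (map Work (blocks f w)))"
  unfolding outside[symmetric] by (rule stretches_blocks)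

lemma starts_on_way: "on_way (letter_pos f org w) e 0 0"
proof -
  \<comment> \<open>This follows from the lemma on single moves, applied to the move \<open>e\<close> from cell \<open>org - 1\<close>.\<close>
  have "letter_pos f org w (org - 1) = org - 1" by (simp add: letter_pos_def excess_def)
  then show ?thesis
    using on_way_step[OF strict_mono_letter_pos, of f org w e "org - 1"] to_origin by simp
qed

lemma image_accepts:
  assumes w: "w \<in> lists X" and acc: "tm_accepts M (tape (map Input w))"
  shows "tm_accepts N (tape' (map Input (word_image f w)))"
proof -
  let ?p = "letter_pos f org w" and ?E = "tape' (map Work (blocks f w))"
  note p = strict_mono_letter_pos[of f org w]
  obtain q i T where q: "q \<in> tm_final M"
    "(tm_step M)\<^sup>*\<^sup>* (tm_init M, 0, tape (map Input w)) (q, i, T)"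
    using acc by (auto simp: tm_accepts_def)
  have "(Run (tm_init M) e, Work Skip, Run (tm_init M) e, Work Skip, e) \<in> tm_trans N"
    by (simp add: image_tm_Run_trans simulating_trans_def)
  note image_tm_skip[OF p stretches_tape starts_on_way this]
  moreover have "tracks_settled ?p (tm_init M, 0, tape (map Input w)) (Run (tm_init M) e, ?p 0, ?E)"
    by (intro tracks_settled.intros stretches_tape)
  then have "\<exists>d'. (tm_step N)\<^sup>*\<^sup>* (Run (tm_init M) e, ?p 0, ?E) d' \<and> tracks_settled ?p (q, i, T) d'"
    by (rule rtranclp_simulation[of _ _ _ "tracks_settled ?p", OF q(2)]) (rule tracks_forward[OF p])
  then obtain d j T' where "(tm_step N)\<^sup>*\<^sup>* (Run (tm_init M) e, ?p 0, ?E) (Run q d, j, T')"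
    by (auto elim: tracks_settled.cases)
  ultimately have "(tm_step N)\<^sup>*\<^sup>* (i0, 0, tape' (map Input (word_image f w))) (Run q d, j, T')"
    using decodes[OF w] by (meson rtranclp_trans)
  moreover have "Run q d \<in> tm_final N" "tm_init N = i0" using q(1) by (auto simp: image_tm_def)
  ultimately show ?thesis by (auto simp: tm_accepts_def)
qed

text \<open>
  The configurations that can occur on input \<open>z\<close>, stage by stage. While decoding, the blocks of a word
  \<open>w\<close> and the part \<open>v\<close> of the current block have been processed and \<open>u\<close> is still unread. The later
  stages remember that \<open>z\<close> is the image of some \<open>w\<close>, and in the last one there is a computation of \<open>M\<close>
  on \<open>w\<close> that has got equally far.
\<close>

inductive phase :: "'b list \<Rightarrow> ('q, 'b) state \<times> int \<times> (int \<Rightarrow> ('b, ('a, 's) cell) symbol) \<Rightarrow> bool"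
  for z where
  starting: "org = 1 \<Longrightarrow> phase z (Start, 0, tape' (map Input z))"
| decoding: "w \<in> lists X \<Longrightarrow> z = word_image f w @ v @ u \<Longrightarrow>
    as = map Work (blocks f w @ replicate (length v) Skip) \<Longrightarrow>
    phase z (Decode v, org + int (length as), tape' (as @ map Input u))"
| rewinding: "w \<in> lists X \<Longrightarrow> z = word_image f w \<Longrightarrow> org - 1 \<le> j \<Longrightarrow>
    j < org + int (length (blocks f w :: ('a, 's) cell list)) \<Longrightarrow>
    phase z (Rewind, j, tape' (map Work (blocks f w)))"
| simulating: "w \<in> lists X \<Longrightarrow> z = word_image f w \<Longrightarrow>
    (tm_step M)\<^sup>*\<^sup>* (tm_init M, 0, tape (map Input w)) c \<Longrightarrow> tracks (letter_pos f org w) c c' \<Longrightarrow>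
    phase z c'"

lemma phase_decoding:
  assumes w: "w \<in> lists X" and z: "z = word_image f w @ v @ u"
    and as: "as = map Work (blocks f w @ replicate (length v) Skip)"
    and step: "tm_step N (Decode v, org + int (length as), tape' (as @ map Input u)) c"
  shows "phase z c"
proof -
  obtain q t d where tr: "(Decode v, tape' (as @ map Input u) (org + int (length as)), q, t, d) \<in> tm_trans N"
    and c: "c = (q, org + int (length as) + shift d, (tape' (as @ map Input u))(org + int (length as) := t))"
    using step by cases auto
  show ?thesis
  proof (cases u)
    case Nil
    have h: "tape' (as @ map Input u) (org + int (length as)) = r"
      using Nil frame_right[of L' R' org as] right by simp
    then have v: "v = []" "q = Rewind" "t = r" "d = MoveLeft"
      using tr right(2) by (auto simp: Decode_trans)
    have "c = (Rewind, org + int (length as) - 1, tape' as)"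
      using c v h Nil by (simp add: fun_upd_idem)
    then show ?thesis using w z v Nil as by (auto intro!: rewinding[of w])
  next
    case (Cons y u')
    have h: "tape' (as @ map Input u) (org + int (length as)) = Input y"
      by (simp add: Cons frame_head)
    from tr[unfolded h] right(2) consider
      "q = Decode (v @ [y])" "t = Work Skip" "d = MoveRight"
      | x where "x \<in> X" "v @ [y] = f x" "q = Decode []" "t = Work (Letter x)" "d = MoveRight"
      by (auto simp: Decode_trans)
    then show ?thesis
    proof cases
      case 1
      have "phase z (Decode (v @ [y]), org + int (length (as @ [t])), tape' ((as @ [t]) @ map Input u'))"
        by (rule decoding[OF w])
          (use z as 1 Cons in \<open>simp_all add: replicate_append_same flip: replicate_Suc\<close>)
      then show ?thesis using c 1 Cons by (simp add: frame_upd ac_simps)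
    next
      case (2 x)
      have "length v = length (f x) - 1" using 2(2) by (metis length_append_singleton diff_Suc_1)
      then have "as @ [t] = map Work (blocks f (w @ [x]) @ replicate (length []) Skip)"
        using as 2 by (simp add: block_def)
      moreover have "z = word_image f (w @ [x]) @ [] @ u'" using z Cons 2(2)[symmetric] by simp
      moreover have "w @ [x] \<in> lists X" using w 2 by simp
      ultimately have "phase z (Decode [], org + int (length (as @ [t])), tape' ((as @ [t]) @ map Input u'))"
        by (intro decoding)
      then show ?thesis using c 2 Cons by (simp add: frame_upd ac_simps)
    qed
  qed
qed

lemma phase_rewinding:
  assumes w: "w \<in> lists X" and z: "z = word_image f w"
    and j: "org - 1 \<le> j" "j < org + int (length (blocks f w :: ('a, 's) cell list))"
    and step: "tm_step N (Rewind, j, tape' (map Work (blocks f w))) c"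
  shows "phase z c"
proof -
  let ?E = "tape' (map Work (blocks f w))"
  obtain q t d where tr: "(Rewind, ?E j, q, t, d) \<in> tm_trans N"
    and c: "c = (q, j + shift d, ?E(j := t))"
    using step by cases auto
  show ?thesis
  proof (cases "j = org - 1")
    case True
    have h: "?E j = l" using left True by (simp add: frame_left)
    have q: "q = Run (tm_init M) e" "t = l" "d = e" using tr left(2) by (auto simp: h Rewind_trans)
    have "c = (Run (tm_init M) e, 0, ?E)" using c h q True to_origin by (simp add: fun_upd_idem)
    moreover have "tracks (letter_pos f org w) (tm_init M, 0, tape (map Input w)) (Run (tm_init M) e, 0, ?E)"
      by (intro tracks.intros stretches_tape starts_on_way)
    ultimately show ?thesis using w z by (auto intro: simulating)
  next
    case False
    then have "?E j = Work (blocks f w ! nat (j - org))" using j by (auto simp: frame_def)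
    then have q: "q = Rewind" "d = MoveLeft" "?E(j := t) = ?E"
      using tr left(2) by (auto simp: Rewind_trans fun_upd_idem)
    show ?thesis unfolding c q using w z j False by (intro rewinding) auto
  qed
qed

lemma phase_step:
  assumes "phase z c" "tm_step N c d"
  shows "phase z d"
  using assms(1)
proof cases
  case starting
  have h: "tape' (map Input z) 0 = l" using \<open>org = 1\<close> left(1) by (simp add: frame_def)
  obtain q t m where "(Start, tape' (map Input z) 0, q, t, m) \<in> tm_trans N"
    and d: "d = (q, 0 + shift m, (tape' (map Input z))(0 := t))"
    using assms(2) unfolding starting(1) by cases auto
  then have "q = Decode []" "t = l" "m = MoveRight" by (simp_all add: h Start_trans)
  then have "d = (Decode [], org + int (length []), tape' ([] @ map Input z))"
    using d h \<open>org = 1\<close> by (simp add: fun_upd_idem)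
  then show ?thesis using decoding[of "[]" z "[]" z "[]"] by simp
next
  case decoding
  then show ?thesis using assms(2) phase_decoding by blast
next
  case rewinding
  then show ?thesis using assms(2) phase_rewinding by blast
next
  case (simulating w c0)
  obtain c1 where c1: "(tm_step M)\<^sup>*\<^sup>* c0 c1" "tracks (letter_pos f org w) c1 d"
    using tracks_backward[OF strict_mono_letter_pos assms(2) simulating(4)] by blast
  show ?thesis
    using simulating(1,2) rtranclp_trans[OF simulating(3) c1(1)] c1(2) by (rule phase.simulating)
qed

lemma accepts_preimage:
  assumes acc: "tm_accepts N (tape' (map Input z))"
  shows "\<exists>w\<in>lists X. z = word_image f w \<and> tm_accepts M (tape (map Input w))"
proof -
  obtain q d j T' where q: "q \<in> tm_final M"
    "(tm_step N)\<^sup>*\<^sup>* (i0, 0, tape' (map Input z)) (Run q d, j, T')"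
    using acc by (auto simp: tm_accepts_def image_tm_def)
  have "phase z (i0, 0, tape' (map Input z))"
    using start decoding[of "[]" z "[]" z "[]"] starting by auto
  with q(2) have "phase z (Run q d, j, T')"
    by (induction rule: rtranclp_induct) (auto intro: phase_step)
  then show ?thesis
  proof cases
    case (simulating w c)
    then obtain i T where "c = (q, i, T)" by (auto elim: tracks.cases)
    then show ?thesis using simulating q(1) by (auto simp: tm_accepts_def)
  qed
qed

end

lemma tm_lang_image:
  assumes f: "\<And>x. x \<in> X \<Longrightarrow> f x \<in> lists Y - {[]}"
  shows "tm_lang Y (image_tm f X M (Decode []) Blank Blank MoveRight) = word_image f ` tm_lang X M"
proof -
  interpret framed_image f X M "\<lambda>_. Blank" "\<lambda>_. Blank" "\<lambda>_. Blank" "\<lambda>_. Blank" 0 "Decode []" Blank Blank MoveRight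
    by unfold_locales (use f in auto)
  have im: "word_image f w \<in> lists Y" if "w \<in> lists X" for w
    using f that by (intro word_image_lists) auto
  show ?thesis
    using image_accepts accepts_preimage im
    by (fastforce simp: tm_lang_accepts tm_tape_frame)
qed

lemma lba_lang_image:
  assumes f: "\<And>x. x \<in> X \<Longrightarrow> f x \<in> lists Y - {[]}"
  shows "lba_lang Y (image_tm f X M Start LeftEnd RightEnd Stay) = word_image f ` lba_lang X M"
proof -
  interpret framed_image f X M "\<lambda>i. if i = 0 then LeftEnd else Blank"
    "\<lambda>i. if i = 0 then RightEnd else Blank" "\<lambda>i. if i = 0 then LeftEnd else Blank"
    "\<lambda>i. if i = 0 then RightEnd else Blank" 1 Start LeftEnd RightEnd Stay
    by unfold_locales (use f in auto)
  have im: "word_image f w \<in> lists Y" if "w \<in> lists X" for w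
    using f that by (intro word_image_lists) auto
  show ?thesis
    using image_accepts accepts_preimage im
    by (fastforce simp: lba_lang_accepts lba_tape_frame)
qed

section \<open>Change of generators\<close>

lemma in_class_subset: "in_class C X L \<Longrightarrow> L \<subseteq> lists X"
  by (cases C) (auto simp: fsa_lang_def pda_lang_def tm_lang_def lba_lang_def)

text \<open>
  The closure property on which the theorem rests: images under nonerasing homomorphisms. Erasing
  homomorphisms are excluded for the sake of the context-sensitive languages, which are not closed
  under them.
\<close>

lemma in_class_image:
  assumes X: "finite X" and f: "\<And>x. x \<in> X \<Longrightarrow> f x \<in> lists Y - {[]}" and L: "in_class C X L"
  shows "in_class C Y (word_image f ` L)"
proof (cases C)
  case Regular
  with L obtain M :: "(nat, 'a) fsa" where M: "is_fsa X M" "L = fsa_lang X M" by auto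
  then show ?thesis
    using in_class_RegularI[OF is_fsa_image[of X f Y M, OF X _ M(1)]] fsa_lang_image[of X f Y M, OF _ M(1)]
      f Regular by simp
next
  case CF
  with L obtain M :: "(nat, 'a, nat) pda" where M: "is_pda X M" "L = pda_lang X M" by auto
  then show ?thesis
    using in_class_CFI[OF is_pda_image[of X f Y M, OF X _ M(1)]] pda_lang_image[of X f Y M, OF _ M(1)]
      f CF by simp
next
  case CS
  with L obtain M :: "(nat, 'a, nat) tm" where M: "is_lba X M" "L = lba_lang X M" by auto
  then show ?thesis
    using in_class_CSI[OF is_lba_image[of X f Y M, OF X f M(1)]] lba_lang_image[of X f Y M, OF f] CS by simp
next
  case RE
  with L obtain M :: "(nat, 'a, nat) tm" where M: "is_tm X M" "L = tm_lang X M" by auto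
  then show ?thesis
    using in_class_REI[OF is_tm_image[of X f Y M, OF X f M(1)]] tm_lang_image[of X f Y M, OF f] RE by simp
qed

text \<open>
  An empty generating set leaves no nonempty words to represent generators by, but then the group is
  trivial and the empty language does what is required.
\<close>

lemma in_class_empty: "in_class C X {}"
proof (cases C)
  case Regular
  have "in_class Regular X (fsa_lang X \<lparr>fsa_init = (), fsa_final = {}, fsa_trans = {}\<rparr>)"
    by (rule in_class_RegularI) (simp add: is_fsa_def)
  then show ?thesis by (simp add: Regular fsa_lang_def)
next
  case CF
  have "in_class CF X
      (pda_lang X \<lparr>pda_init = (), pda_bottom = 0 :: nat, pda_final = {}, pda_trans = {}\<rparr>)"
    by (rule in_class_CFI) (simp add: is_pda_def)
  then show ?thesis by (simp add: CF pda_lang_def)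
next
  case CS
  have "in_class CS X (lba_lang X
      \<lparr>tm_init = (), tm_final = {}, tm_trans = {} :: (unit \<times> ('a, unit) symbol \<times> _) set\<rparr>)"
    by (rule in_class_CSI) (simp add: is_lba_def)
  then show ?thesis by (simp add: CS lba_lang_def)
next
  case RE
  have "in_class RE X (tm_lang X
      \<lparr>tm_init = (), tm_final = {}, tm_trans = {} :: (unit \<times> ('a, unit) symbol \<times> _) set\<rparr>)"
    by (rule in_class_REI) (simp add: is_tm_def)
  then show ?thesis by (simp add: RE tm_lang_def)
qed

context group
begin

lemma word_value_closed: "w \<in> lists (carrier G) \<Longrightarrow> word_value G w \<in> carrier G"
  by (induction w) (auto simp: word_value_def)

lemma word_value_append:
  "u \<in> lists (carrier G) \<Longrightarrow> v \<in> lists (carrier G) \<Longrightarrow>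
     word_value G (u @ v) = word_value G u \<otimes> word_value G v"
  by (induction u rule: list.induct)
    (use word_value_closed in \<open>auto simp: word_value_def m_assoc\<close>)

lemma word_value_image:
  assumes "w \<in> lists X" "\<And>x. x \<in> X \<Longrightarrow> f x \<in> lists (carrier G) \<and> word_value G (f x) = x"
  shows "word_value G (word_image f w) = word_value G w"
  using assms(1)
proof induction
  case (Cons x w)
  have "word_image f w \<in> lists (carrier G)"
    using assms(2) Cons.hyps(2) by (intro word_image_lists) auto
  then show ?case
    using Cons assms(2)[of x] by (simp add: word_value_append) (simp add: word_value_def)
qed (simp add: word_value_def)

text \<open>
  A word for \<open>g\<close> may be empty, namely when \<open>g\<close> is the identity; prefixing a word for
  \<open>inv y \<otimes> g\<close> with a generator \<open>y\<close> avoids this.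
\<close>

lemma nonempty_word_for:
  assumes Y: "generates_as_monoid G Y" "Y \<noteq> {}" and g: "g \<in> carrier G"
  obtains w where "w \<in> lists Y - {[]}" "word_value G w = g"
proof -
  obtain y where y: "y \<in> Y" "y \<in> carrier G" using Y by (auto simp: generates_as_monoid_def)
  obtain v where v: "v \<in> lists Y" "word_value G v = inv y \<otimes> g"
    using Y(1) y g by (meson generates_as_monoid_def inv_closed m_closed)
  have "word_value G (y # v) = y \<otimes> (inv y \<otimes> g)" using v(2) by (simp add: word_value_def)
  also have "\<dots> = g" using y g by (simp add: m_assoc[symmetric])
  finally show thesis using that[of "y # v"] y v by auto
qed

end

theorem theoremA:
  fixes G :: "('a, 'b) monoid_scheme" and X Y :: "'a set" and C :: lang_class
  assumes "group G"
    and "X \<subseteq> carrier G" and "finite X" and "generates_as_monoid G X"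
    and "Y \<subseteq> carrier G" and "finite Y" and "generates_as_monoid G Y"
    and "epiC C G X"
  shows "epiC C G Y"
proof -
  interpret group G by fact
  obtain L where L: "in_class C X L" "\<And>w. w \<in> L \<Longrightarrow> word_value G w \<noteq> \<one>\<^bsub>G\<^esub>"
    "\<And>h. h \<in> carrier G - {\<one>\<^bsub>G\<^esub>} \<Longrightarrow> \<exists>w\<in>L. word_value G w = h"
    using \<open>epiC C G X\<close> unfolding epiC_def by blast
  show ?thesis
  proof (cases "Y = {}")
    case True
    then have "carrier G - {\<one>\<^bsub>G\<^esub>} = {}"
      using \<open>generates_as_monoid G Y\<close> by (auto simp: generates_as_monoid_def word_value_def)
    then show ?thesis using in_class_empty[of C Y] by (auto simp: epiC_def)
  next
    case False
    have "\<exists>w. w \<in> lists Y - {[]} \<and> word_value G w = x" if "x \<in> X" for x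
      using that assms(2) nonempty_word_for[OF assms(7) False, of x] by blast
    then obtain f where f: "\<And>x. x \<in> X \<Longrightarrow> f x \<in> lists Y - {[]}"
      "\<And>x. x \<in> X \<Longrightarrow> word_value G (f x) = x"
      by metis
    have same_value: "word_value G (word_image f w) = word_value G w" if "w \<in> L" for w
      using that in_class_subset[OF L(1)] f assms(5)
      by (intro word_value_image[where X = X]) (blast, use lists_mono[OF assms(5)] in blast)
    have "in_class C Y (word_image f ` L)" using \<open>finite X\<close> f(1) L(1) by (rule in_class_image)
    moreover from this have "word_image f ` L \<subseteq> lists Y" by (rule in_class_subset)
    ultimately show ?thesis
      unfolding epiC_def using L(2,3) same_value
      by (intro exI[of _ "word_image f ` L"]) fastforce
  qed
qed

end
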